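(* Suppose the $\Gamma$-odometer $(\mathfrak{X},\Gamma,\Phi)$ and the $\Gamma'$-odometer $(\mathfrak{X}',\Gamma',\Phi')$ are return equivalent. Then their typesets $\Xi[\mathfrak{X},\Gamma,\Phi]$ and $\Xi[\mathfrak{X}',\Gamma',\Phi']$ are commensurable.
   Context: Odometers. A Cantor action $(\mathfrak{X},\Gamma,\Phi)$ is an action of a group $\Gamma$ by homeomorphisms on a Cantor space $\mathfrak{X}$; write $g\cdot x=\Phi(g)(x)$. It is minimal if every orbit is dense, and equicontinuous if for a (equivalently any) metric $d_{\mathfrak{X}}$ compatible with the topology, for all $\varepsilon>0$ there is $\delta>0$ such that $d_{\mathfrak{X}}(x,y)<\delta$ implies $d_{\mathfrak{X}}(g\cdot x,g\cdot y)<\varepsilon$ for all $g\in\Gamma$. A ($\Gamma$-)odometer is a minimal equicontinuous Cantor action. Return equivalence. A non-empty clopen set $U\subset\mathfrak{X}$ is adapted if for all $g\in\Gamma$, $g\cdot U\cap U\neq\emptyset$ implies $g\cdot U=U$; then $\Gamma_U=\{g\in\Gamma\mid g\cdot U\cap U\ne\emptyset\}$ is a finite index subgroup which acts on $U$; let $\mathcal{H}_U\subset\mathrm{Homeo}(U)$ be the image of $\Gamma_U$, acting on $U$ by $\Phi_U$. Actions $(\mathfrak{X}_1,\Gamma_1,\Phi_1)$, $(\mathfrak{X}_2,\Gamma_2,\Phi_2)$ are isomorphic if there are a homeomorphism $h\colon\mathfrak{X}_1\to\mathfrak{X}_2$ and a group isomorphism $\Theta\colon\Gamma_1\to\Gamma_2$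 with $\Phi_1(g)=h^{-1}\circ\Phi_2(\Theta(g))\circ h$ for all $g\in\Gamma_1$. Odometers $(\mathfrak{X},\Gamma,\Phi)$ and $(\mathfrak{X}',\Gamma',\Phi')$ are return equivalent if there are adapted sets $U\subset\mathfrak{X}$, $U'\subset\mathfrak{X}'$ such that $(U,\mathcal{H}_U,\Phi_U)$ and $(U',\mathcal{H}'_{U'},\Phi'_{U'})$ are isomorphic. Group chain models. A group chain $\mathcal{G}=\{\Gamma=\Gamma_0\supset\Gamma_1\supset\cdots\}$ is a descending chain of finite index subgroups (not assumed normal). Put $X_\ell=\Gamma/\Gamma_\ell$, $X_\infty=\varprojlim\{X_{\ell+1}\to X_\ell\}$, with $\Phi_\infty$ the action of $\Gamma$ on $X_\infty$ induced by left multiplication. $\mathcal{G}$ is a group chain model for $(\mathfrak{X},\Gamma,\Phi)$ if there is a homeomorphism $\mathfrak{X}\to X_\infty$ conjugating $\Phi$ to $\Phi_\infty$ (as $\Gamma$-actions). Every odometer is known to have a group chain model. Types and typesets. A Steinitz number is a formal product $\xi=\prod_{p}p^{\chi_\xi(p)}$ over all primes $p$, with $\chi_\xi(p)\in\{0,1,\ldots,\infty\}$; the least common multiple of a collection of positive integers is a Steinitz number, with exponent at $p$ the supremum of the exponents. $\xi,\xi'$ are asymptotically equivalent if $m\cdot\xi=m'\cdot\xi'$ for some integers $m,m'\ge1$; the equivalence class of $\xi$ is its type $\tau[\xi]$. For a group chain $\mathcal{G}$ and a finite index subgroup $H\subset\Gamma$ with $\Gamma_\ell\subset H$ for some $\ell\geq1$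 (after omitting initial terms of the chain one may take $\Gamma_1\subset H$), set $C^H_\ell=\bigcap_{\delta\in H}\delta\Gamma_\ell\delta^{-1}$, and for $\gamma\in\Gamma$ set $C^H_{\gamma,\ell}=\langle\gamma\rangle\cap C^H_\ell$ and $\xi^H(\gamma)=\mathrm{lcm}\{\#(\langle\gamma\rangle/C^H_{\gamma,\ell})\mid\ell>0\}$. The $H$-restricted typeset is $\Xi_H[\mathcal{G}]=\{\tau[\xi^H(\gamma)]\mid\gamma\in\Gamma\}$, and the typeset is $\Xi[\mathcal{G}]=\Xi_\Gamma[\mathcal{G}]$. The typeset of the odometer is $\Xi[\mathfrak{X},\Gamma,\Phi]=\Xi[\mathcal{G}]$ for a choice of group chain model $\mathcal{G}$ (it does not depend on the choice). Commensurability. For group chains $\mathcal{G}$ in $\Gamma$ and $\mathcal{G}'$ in $\Gamma'$, the typesets $\Xi[\mathcal{G}]$ and $\Xi[\mathcal{G}']$ are commensurable if there exist a finite index subgroup $H\subset\Gamma$ with $\Gamma_\ell\subset H$ for some $\ell\ge1$, and a finite index subgroup $H'\subset\Gamma'$ with $\Gamma'_{\ell'}\subset H'$ for some $\ell'\ge1$, such that $\Xi_H[\mathcal{G}]=\Xi_{H'}[\mathcal{G}']$. The typesets of two odometers are commensurable if this holds for $\Xi[\mathcal{G}]$ and $\Xi[\mathcal{G}']$, with $\mathcal{G},\mathcal{G}'$ group chain models of the two odometers. *)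

theory Defs
  imports
    "HOL-Analysis.Analysis"
    "HOL-Algebra.Group_Action"
    "HOL-Algebra.Left_Coset"
    "HOL-Algebra.Generated_Groups"
    "HOL-Library.Extended_Nat"
    "HOL-Computational_Algebra.Primes"
begin

section \<open>Odometers\<close>

definition cantor_space :: "'x topology \<Rightarrow> bool" where
  "cantor_space X \<longleftrightarrow>
     X homeomorphic_space product_topology (\<lambda>_::nat. discrete_topology (UNIV :: bool set)) UNIV"

text \<open>As \<open>group_action\<close> is a homomorphism into \<open>BijGroup\<close>, each \<open>\<Phi> g\<close> is
  \<open>undefined\<close> outside \<open>topspace X\<close>.\<close>

definition cantor_action ::
    "'x topology \<Rightarrow> ('g, 'm) monoid_scheme \<Rightarrow> ('g \<Rightarrow> 'x \<Rightarrow> 'x) \<Rightarrow> bool" where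
  "cantor_action X \<Gamma> \<Phi> \<longleftrightarrow>
     cantor_space X \<and> group_action \<Gamma> (topspace X) \<Phi> \<and>
     (\<forall>g\<in>carrier \<Gamma>. homeomorphic_map X X (\<Phi> g))"

definition minimal_action ::
    "'x topology \<Rightarrow> ('g, 'm) monoid_scheme \<Rightarrow> ('g \<Rightarrow> 'x \<Rightarrow> 'x) \<Rightarrow> bool" where
  "minimal_action X \<Gamma> \<Phi> \<longleftrightarrow>
     (\<forall>x\<in>topspace X. X closure_of (orbit \<Gamma> \<Phi> x) = topspace X)"

definition equicontinuous_action ::
    "'x topology \<Rightarrow> ('g, 'm) monoid_scheme \<Rightarrow> ('g \<Rightarrow> 'x \<Rightarrow> 'x) \<Rightarrow> bool" where
  "equicontinuous_action X \<Gamma> \<Phi> \<longleftrightarrow>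
     (\<exists>d. Metric_space (topspace X) d \<and> Metric_space.mtopology (topspace X) d = X \<and>
        (\<forall>\<epsilon>>0. \<exists>\<delta>>0. \<forall>x\<in>topspace X. \<forall>y\<in>topspace X. d x y < \<delta> \<longrightarrow>
           (\<forall>g\<in>carrier \<Gamma>. d (\<Phi> g x) (\<Phi> g y) < \<epsilon>)))"

definition odometer ::
    "'x topology \<Rightarrow> ('g, 'm) monoid_scheme \<Rightarrow> ('g \<Rightarrow> 'x \<Rightarrow> 'x) \<Rightarrow> bool" where
  "odometer X \<Gamma> \<Phi> \<longleftrightarrow>
     cantor_action X \<Gamma> \<Phi> \<and> minimal_action X \<Gamma> \<Phi> \<and> equicontinuous_action X \<Gamma> \<Phi>"


section \<open>Return equivalence\<close>

definition adapted ::
    "'x topology \<Rightarrow> ('g, 'm) monoid_scheme \<Rightarrow> ('g \<Rightarrow> 'x \<Rightarrow> 'x) \<Rightarrow> 'x set \<Rightarrow> bool" where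
  "adapted X \<Gamma> \<Phi> U \<longleftrightarrow>
     U \<noteq> {} \<and> openin X U \<and> closedin X U \<and>
     (\<forall>g\<in>carrier \<Gamma>. \<Phi> g ` U \<inter> U \<noteq> {} \<longrightarrow> \<Phi> g ` U = U)"

definition return_subgroup ::
    "('g, 'm) monoid_scheme \<Rightarrow> ('g \<Rightarrow> 'x \<Rightarrow> 'x) \<Rightarrow> 'x set \<Rightarrow> 'g set" where
  "return_subgroup \<Gamma> \<Phi> U = {g \<in> carrier \<Gamma>. \<Phi> g ` U \<inter> U \<noteq> {}}"

text \<open>The image of the return subgroup in the group of permutations of \<open>U\<close>; it acts on \<open>U\<close> by
  evaluation.\<close>

definition holonomy_group ::
    "('g, 'm) monoid_scheme \<Rightarrow> ('g \<Rightarrow> 'x \<Rightarrow> 'x) \<Rightarrow> 'x set \<Rightarrow> ('x \<Rightarrow> 'x) monoid" where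
  "holonomy_group \<Gamma> \<Phi> U =
     BijGroup U \<lparr>carrier := (\<lambda>g. restrict (\<Phi> g) U) ` return_subgroup \<Gamma> \<Phi> U\<rparr>"

definition isomorphic_actions ::
    "'x topology \<Rightarrow> ('g, 'm) monoid_scheme \<Rightarrow> ('g \<Rightarrow> 'x \<Rightarrow> 'x) \<Rightarrow>
     'y topology \<Rightarrow> ('h, 'n) monoid_scheme \<Rightarrow> ('h \<Rightarrow> 'y \<Rightarrow> 'y) \<Rightarrow> bool" where
  "isomorphic_actions X\<^sub>1 \<Gamma>\<^sub>1 \<Phi>\<^sub>1 X\<^sub>2 \<Gamma>\<^sub>2 \<Phi>\<^sub>2 \<longleftrightarrow>
     (\<exists>h h' \<Theta>. homeomorphic_maps X\<^sub>1 X\<^sub>2 h h' \<and> \<Theta> \<in> iso \<Gamma>\<^sub>1 \<Gamma>\<^sub>2 \<and>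
        (\<forall>g\<in>carrier \<Gamma>\<^sub>1. \<forall>x\<in>topspace X\<^sub>1. \<Phi>\<^sub>1 g x = h' (\<Phi>\<^sub>2 (\<Theta> g) (h x))))"

definition return_equivalent ::
    "'x topology \<Rightarrow> ('g, 'm) monoid_scheme \<Rightarrow> ('g \<Rightarrow> 'x \<Rightarrow> 'x) \<Rightarrow>
     'y topology \<Rightarrow> ('h, 'n) monoid_scheme \<Rightarrow> ('h \<Rightarrow> 'y \<Rightarrow> 'y) \<Rightarrow> bool" where
  "return_equivalent X \<Gamma> \<Phi> X' \<Gamma>' \<Phi>' \<longleftrightarrow>
     (\<exists>U U'. adapted X \<Gamma> \<Phi> U \<and> adapted X' \<Gamma>' \<Phi>' U' \<and>
        isomorphic_actions
          (subtopology X U) (holonomy_group \<Gamma> \<Phi> U) (\<lambda>f x. f x)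
          (subtopology X' U') (holonomy_group \<Gamma>' \<Phi>' U') (\<lambda>f x. f x))"


section \<open>Group chain models\<close>

definition finite_index_subgroup :: "'g set \<Rightarrow> ('g, 'm) monoid_scheme \<Rightarrow> bool" where
  "finite_index_subgroup H \<Gamma> \<longleftrightarrow> subgroup H \<Gamma> \<and> finite (lcosets\<^bsub>\<Gamma>\<^esub> H)"

text \<open>Chains need not be strictly decreasing.\<close>

definition group_chain :: "('g, 'm) monoid_scheme \<Rightarrow> (nat \<Rightarrow> 'g set) \<Rightarrow> bool" where
  "group_chain \<Gamma> G \<longleftrightarrow>
     G 0 = carrier \<Gamma> \<and> (\<forall>l. finite_index_subgroup (G l) \<Gamma> \<and> G (Suc l) \<subseteq> G l)"

text \<open>The bonding map sends \<open>g\<Gamma>\<^bsub>l+1\<^esub>\<close> to \<open>g\<Gamma>\<^bsub>l\<^esub> = g\<Gamma>\<^bsub>l+1\<^esub>\<Gamma>\<^bsub>l\<^esub>\<close>.\<close>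

definition chain_limit :: "('g, 'm) monoid_scheme \<Rightarrow> (nat \<Rightarrow> 'g set) \<Rightarrow> (nat \<Rightarrow> 'g set) topology" where
  "chain_limit \<Gamma> G =
     subtopology (product_topology (\<lambda>l. discrete_topology (lcosets\<^bsub>\<Gamma>\<^esub> (G l))) UNIV)
       {c. \<forall>l. c l = c (Suc l) <#>\<^bsub>\<Gamma>\<^esub> G l}"

definition chain_action :: "('g, 'm) monoid_scheme \<Rightarrow> 'g \<Rightarrow> (nat \<Rightarrow> 'g set) \<Rightarrow> (nat \<Rightarrow> 'g set)" where
  "chain_action \<Gamma> g c = (\<lambda>l. g <#\<^bsub>\<Gamma>\<^esub> c l)"

definition group_chain_model ::
    "'x topology \<Rightarrow> ('g, 'm) monoid_scheme \<Rightarrow> ('g \<Rightarrow> 'x \<Rightarrow> 'x) \<Rightarrow> (nat \<Rightarrow> 'g set) \<Rightarrow> bool" where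
  "group_chain_model X \<Gamma> \<Phi> G \<longleftrightarrow>
     group_chain \<Gamma> G \<and>
     (\<exists>h. homeomorphic_map X (chain_limit \<Gamma> G) h \<and>
        (\<forall>g\<in>carrier \<Gamma>. \<forall>x\<in>topspace X. h (\<Phi> g x) = chain_action \<Gamma> g (h x)))"


section \<open>Steinitz numbers and types\<close>

text \<open>A Steinitz number is represented by its exponent function, set to 0 at non-primes so that
  equality of functions is equality of Steinitz numbers; multiplication is addition of exponents.\<close>

type_synonym steinitz = "nat \<Rightarrow> enat"

definition steinitz_numbers :: "steinitz set" where
  "steinitz_numbers = {\<xi>. \<forall>p. \<not> prime p \<longrightarrow> \<xi> p = 0}"

definition steinitz_of_nat :: "nat \<Rightarrow> steinitz" where
  "steinitz_of_nat n = (\<lambda>p. if prime p then enat (multiplicity p n) else 0)"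

definition steinitz_mult :: "steinitz \<Rightarrow> steinitz \<Rightarrow> steinitz" where
  "steinitz_mult \<xi> \<xi>' = (\<lambda>p. \<xi> p + \<xi>' p)"

definition steinitz_lcm :: "nat set \<Rightarrow> steinitz" where
  "steinitz_lcm A = (\<lambda>p. SUP n\<in>A. steinitz_of_nat n p)"

definition asymp_equivalent :: "steinitz \<Rightarrow> steinitz \<Rightarrow> bool" where
  "asymp_equivalent \<xi> \<xi>' \<longleftrightarrow>
     (\<exists>m m'. m \<ge> 1 \<and> m' \<ge> 1 \<and>
        steinitz_mult (steinitz_of_nat m) \<xi> = steinitz_mult (steinitz_of_nat m') \<xi>')"

definition steinitz_type :: "steinitz \<Rightarrow> steinitz set" where
  "steinitz_type \<xi> = {\<xi>' \<in> steinitz_numbers. asymp_equivalent \<xi> \<xi>'}"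


section \<open>Typesets\<close>

definition restricted_core ::
    "('g, 'm) monoid_scheme \<Rightarrow> (nat \<Rightarrow> 'g set) \<Rightarrow> 'g set \<Rightarrow> nat \<Rightarrow> 'g set" where
  "restricted_core \<Gamma> G H l = (\<Inter>\<delta>\<in>H. (\<lambda>x. \<delta> \<otimes>\<^bsub>\<Gamma>\<^esub> x \<otimes>\<^bsub>\<Gamma>\<^esub> inv\<^bsub>\<Gamma>\<^esub> \<delta>) ` G l)"

definition cyclic_core ::
    "('g, 'm) monoid_scheme \<Rightarrow> (nat \<Rightarrow> 'g set) \<Rightarrow> 'g set \<Rightarrow> 'g \<Rightarrow> nat \<Rightarrow> 'g set" where
  "cyclic_core \<Gamma> G H \<gamma> l = generate \<Gamma> {\<gamma>} \<inter> restricted_core \<Gamma> G H l"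

definition steinitz_order ::
    "('g, 'm) monoid_scheme \<Rightarrow> (nat \<Rightarrow> 'g set) \<Rightarrow> 'g set \<Rightarrow> 'g \<Rightarrow> steinitz" where
  "steinitz_order \<Gamma> G H \<gamma> =
     steinitz_lcm {order (\<Gamma>\<lparr>carrier := generate \<Gamma> {\<gamma>}\<rparr> Mod cyclic_core \<Gamma> G H \<gamma> l) | l. l > 0}"

definition restricted_typeset ::
    "('g, 'm) monoid_scheme \<Rightarrow> (nat \<Rightarrow> 'g set) \<Rightarrow> 'g set \<Rightarrow> steinitz set set" where
  "restricted_typeset \<Gamma> G H = {steinitz_type (steinitz_order \<Gamma> G H \<gamma>) | \<gamma>. \<gamma> \<in> carrier \<Gamma>}"

text \<open>The typeset of a chain is \<open>restricted_typeset \<Gamma> G (carrier \<Gamma>)\<close>. Commensurability compares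
  restricted typesets, so it is a relation between the chains defining the two typesets.\<close>

definition commensurable_typesets ::
    "('g, 'm) monoid_scheme \<Rightarrow> (nat \<Rightarrow> 'g set) \<Rightarrow>
     ('h, 'n) monoid_scheme \<Rightarrow> (nat \<Rightarrow> 'h set) \<Rightarrow> bool" where
  "commensurable_typesets \<Gamma> G \<Gamma>' G' \<longleftrightarrow>
     (\<exists>H H'. finite_index_subgroup H \<Gamma> \<and> (\<exists>l\<ge>1. G l \<subseteq> H) \<and>
        finite_index_subgroup H' \<Gamma>' \<and> (\<exists>l'\<ge>1. G' l' \<subseteq> H') \<and>
        restricted_typeset \<Gamma> G H = restricted_typeset \<Gamma>' G' H')"

text \<open>Every odometer has a group chain model, and the choice of models is immaterial; we ask for
  commensurability for every choice.\<close>

definition odometer_typesets_commensurable ::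
    "'x topology \<Rightarrow> ('g, 'm) monoid_scheme \<Rightarrow> ('g \<Rightarrow> 'x \<Rightarrow> 'x) \<Rightarrow>
     'y topology \<Rightarrow> ('h, 'n) monoid_scheme \<Rightarrow> ('h \<Rightarrow> 'y \<Rightarrow> 'y) \<Rightarrow> bool" where
  "odometer_typesets_commensurable X \<Gamma> \<Phi> X' \<Gamma>' \<Phi>' \<longleftrightarrow>
     (\<forall>G G'. group_chain_model X \<Gamma> \<Phi> G \<and> group_chain_model X' \<Gamma>' \<Phi>' G' \<longrightarrow>
        commensurable_typesets \<Gamma> G \<Gamma>' G')"

end

theory Submission
  imports Defs "HOL-Algebra.Multiplicative_Group"
begin

text \<open>
  Let \<open>U\<close> be an adapted set containing the base point of a group chain model with chain \<open>C\<close>, and let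
  \<open>H\<close> be its return subgroup. By minimality the cosets \<open>\<delta> C\<^sub>l\<close> with \<open>\<delta> \<in> H\<close> are exactly the level \<open>l\<close>
  coordinates of the points of \<open>U\<close>, so an element lies in the restricted core of \<open>C\<^sub>l\<close> iff it
  preserves these coordinates on \<open>U\<close>. For \<open>\<gamma> \<in> H\<close> the Steinitz order is therefore the least common
  multiple of the orders with which the homeomorphism \<open>\<gamma>\<close> of \<open>U\<close> permutes the pieces of a separating
  sequence of finite clopen partitions. By compactness any two such sequences refine each other, so
  this number depends only on the conjugacy class of the homeomorphism, and an isomorphism of the
  holonomy actions matches the numbers on both sides. Elements outside \<open>H\<close> contribute nothing new:
  some positive power lies in \<open>H\<close>, and passing to a power does not change the type.
\<close>


section \<open>Steinitz numbers and orders in cyclic quotients\<close>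

text \<open>Everything divides 0, yet 0 has multiplicity 0 at every prime; asking for
  \<open>b \<noteq> 0\<close> makes divisibility monotone in the exponents.\<close>

lemma steinitz_lcm_mono:
  assumes "\<And>a. a \<in> A \<Longrightarrow> \<exists>b\<in>B. b \<noteq> 0 \<and> a dvd b"
  shows "steinitz_lcm A \<le> steinitz_lcm B"
proof (rule le_funI)
  fix p
  show "steinitz_lcm A p \<le> steinitz_lcm B p"
    unfolding steinitz_lcm_def
  proof (rule SUP_least)
    fix a assume "a \<in> A"
    then obtain b where b: "b \<in> B" "b \<noteq> 0" "a dvd b" using assms by blast
    have "steinitz_of_nat a p \<le> steinitz_of_nat b p"
      using b dvd_imp_multiplicity_le by (auto simp: steinitz_of_nat_def)
    also have "\<dots> \<le> (SUP n\<in>B. steinitz_of_nat n p)"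
      using b(1) by (rule SUP_upper)
    finally show "steinitz_of_nat a p \<le> (SUP n\<in>B. steinitz_of_nat n p)" .
  qed
qed

lemma steinitz_of_nat_mult:
  assumes "m \<noteq> 0" "n \<noteq> 0"
  shows "steinitz_of_nat (m * n) = steinitz_mult (steinitz_of_nat m) (steinitz_of_nat n)"
  using assms
  by (auto simp: steinitz_of_nat_def steinitz_mult_def fun_eq_iff prime_elem_multiplicity_mult_distrib)

lemma steinitz_mult_assoc:
  "steinitz_mult (steinitz_mult \<xi> \<eta>) \<zeta> = steinitz_mult \<xi> (steinitz_mult \<eta> \<zeta>)"
  by (simp add: steinitz_mult_def add.assoc)

text \<open>The finite factor \<open>d\<close> is absorbed by the integer multipliers that
  asymptotic equivalence allows: by \<open>m\<close> in one direction, by \<open>m'\<close> in the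
  other.\<close>

lemma steinitz_type_mult_of_nat:
  assumes "d \<noteq> 0"
  shows "steinitz_type (steinitz_mult (steinitz_of_nat d) \<xi>) = steinitz_type \<xi>"
proof -
  have "asymp_equivalent (steinitz_mult (steinitz_of_nat d) \<xi>) \<xi>' \<longleftrightarrow> asymp_equivalent \<xi> \<xi>'" for \<xi>'
  proof
    assume "asymp_equivalent (steinitz_mult (steinitz_of_nat d) \<xi>) \<xi>'"
    then obtain m m' where m: "m \<ge> 1" "m' \<ge> 1"
      "steinitz_mult (steinitz_of_nat m) (steinitz_mult (steinitz_of_nat d) \<xi>)
         = steinitz_mult (steinitz_of_nat m') \<xi>'"
      unfolding asymp_equivalent_def by blast
    then have "steinitz_mult (steinitz_of_nat (m * d)) \<xi> = steinitz_mult (steinitz_of_nat m') \<xi>'"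
      using assms by (simp add: steinitz_of_nat_mult steinitz_mult_assoc)
    with m assms show "asymp_equivalent \<xi> \<xi>'"
      unfolding asymp_equivalent_def by (intro exI[of _ "m * d"] exI[of _ m']) auto
  next
    assume "asymp_equivalent \<xi> \<xi>'"
    then obtain m m' where m: "m \<ge> 1" "m' \<ge> 1"
      "steinitz_mult (steinitz_of_nat m) \<xi> = steinitz_mult (steinitz_of_nat m') \<xi>'"
      unfolding asymp_equivalent_def by blast
    then have "steinitz_mult (steinitz_of_nat (d * m)) \<xi> = steinitz_mult (steinitz_of_nat (d * m')) \<xi>'"
      using assms by (simp add: steinitz_of_nat_mult steinitz_mult_assoc)
    then have "steinitz_mult (steinitz_of_nat m) (steinitz_mult (steinitz_of_nat d) \<xi>)
        = steinitz_mult (steinitz_of_nat (d * m')) \<xi>'"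
      using assms m by (simp add: mult.commute[of d m] steinitz_of_nat_mult steinitz_mult_assoc)
    with m assms show "asymp_equivalent (steinitz_mult (steinitz_of_nat d) \<xi>) \<xi>'"
      unfolding asymp_equivalent_def by (intro exI[of _ "m"] exI[of _ "d * m'"]) auto
  qed
  then show ?thesis by (simp add: steinitz_type_def)
qed

text \<open>A finite summand can be cancelled in \<open>enat\<close>, which turns the first
  inequality into one for suprema. Over the empty set the right side would be 0 for any
  \<open>c\<close>.\<close>

lemma enat_add_SUP:
  fixes f :: "'a \<Rightarrow> enat"
  assumes "A \<noteq> {}"
  shows "enat c + (SUP a\<in>A. f a) = (SUP a\<in>A. enat c + f a)"
proof (rule antisym)
  have "f a \<le> (SUP a\<in>A. enat c + f a) - enat c" if "a \<in> A" for a
  proof -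
    have "enat c + f a \<le> (SUP a\<in>A. enat c + f a)"
      using that by (rule SUP_upper)
    then show ?thesis
      by (cases "f a"; cases "SUP a\<in>A. enat c + f a") auto
  qed
  then have le: "(SUP a\<in>A. f a) \<le> (SUP a\<in>A. enat c + f a) - enat c"
    by (rule SUP_least)
  have ge: "enat c \<le> (SUP a\<in>A. enat c + f a)"
    using assms by (metis SUP_upper2 ex_in_conv le_iff_add)
  show "enat c + (SUP a\<in>A. f a) \<le> (SUP a\<in>A. enat c + f a)"
    using le ge
    by (cases "SUP a\<in>A. f a"; cases "SUP a\<in>A. enat c + f a") auto
  show "(SUP a\<in>A. enat c + f a) \<le> enat c + (SUP a\<in>A. f a)"
    by (intro SUP_least add_left_mono SUP_upper)
qed

lemma steinitz_lcm_mult: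
  assumes "A \<noteq> {}" "0 \<notin> A" "d \<noteq> 0"
  shows "steinitz_lcm ((*) d ` A) = steinitz_mult (steinitz_of_nat d) (steinitz_lcm A)"
proof
  fix p
  have "(SUP n\<in>(*) d ` A. steinitz_of_nat n p) = (SUP n\<in>A. steinitz_of_nat (d * n) p)"
    by (simp add: image_image)
  also have "\<dots> = (SUP n\<in>A. steinitz_of_nat d p + steinitz_of_nat n p)"
    using assms(2,3)
    by (intro SUP_cong refl) (metis steinitz_of_nat_mult steinitz_mult_def)
  also have "\<dots> = steinitz_of_nat d p + (SUP n\<in>A. steinitz_of_nat n p)"
    using enat_add_SUP[OF assms(1), of "if prime p then multiplicity p d else 0"
        "\<lambda>n. steinitz_of_nat n p"]
    by (simp add: steinitz_of_nat_def zero_enat_def split: if_splits)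
  finally show "steinitz_lcm ((*) d ` A) p = steinitz_mult (steinitz_of_nat d) (steinitz_lcm A) p"
    by (simp add: steinitz_lcm_def steinitz_mult_def)
qed

text \<open>Each early term divides a later one, so any tail carries all exponents. This permits
  restricting to the range where an auxiliary gcd is constant.\<close>

lemma steinitz_lcm_tail:
  fixes N :: "nat \<Rightarrow> nat"
  assumes "\<And>l. N l > 0" "\<And>l. N l dvd N (Suc l)"
  shows "steinitz_lcm {N l | l. l > 0} = steinitz_lcm {N l | l. l > L}"
proof (rule antisym)
  have dvd: "N l dvd N (l + k)" for l k
    by (induction k) (auto intro: dvd_trans[OF _ assms(2)])
  show "steinitz_lcm {N l | l. l > 0} \<le> steinitz_lcm {N l | l. l > L}"
  proof (rule steinitz_lcm_mono)
    fix a assume "a \<in> {N l | l. l > 0}"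
    then obtain l where "a = N l" "l > 0" by blast
    then show "\<exists>b\<in>{N l | l. l > L}. b \<noteq> 0 \<and> a dvd b"
      using dvd[of l L] assms(1)[of "l + L"] by (intro bexI[of _ "N (l + L)"]) auto
  qed
  show "steinitz_lcm {N l | l. l > L} \<le> steinitz_lcm {N l | l. l > 0}"
  proof (rule steinitz_lcm_mono)
    fix a assume "a \<in> {N l | l. l > L}"
    then obtain l where "a = N l" "l > L" by blast
    then show "\<exists>b\<in>{N l | l. l > 0}. b \<noteq> 0 \<and> a dvd b"
      using assms(1)[of l] by (intro bexI[of _ "N l"]) auto
  qed
qed

text \<open>Arithmetic form of the order of a power: if an element has order \<open>n\<close>, its
  \<open>j\<close>-th power has order \<open>n div gcd n j\<close>. After removal of the gcd the
  cofactors are coprime.\<close>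

lemma div_gcd_dvd_iff:
  fixes n j k :: nat
  assumes "j > 0"
  shows "n div gcd n j dvd k \<longleftrightarrow> n dvd j * k"
proof -
  define g a b where "g = gcd n j" and "a = n div g" and "b = j div g"
  have g: "g > 0" and n: "n = g * a" and j: "j = g * b"
    using assms unfolding a_def b_def g_def by simp_all
  have "coprime a b"
    unfolding a_def b_def g_def using assms by (intro div_gcd_coprime) auto
  have "n dvd j * k \<longleftrightarrow> a dvd b * k"
    unfolding n j using g by (simp add: mult.assoc)
  also have "\<dots> \<longleftrightarrow> a dvd k"
    using \<open>coprime a b\<close> by (rule coprime_dvd_mult_right_iff)
  finally show ?thesis unfolding a_def g_def by simp
qed

text \<open>The increasing sequence \<open>gcd (N l) j\<close> of divisors of \<open>j\<close> is eventually a constant \<open>d\<close>, and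
  beyond that point the two sequences differ by the factor \<open>d\<close>.\<close>

lemma steinitz_type_lcm_div_gcd:
  fixes N :: "nat \<Rightarrow> nat"
  assumes pos: "\<And>l. N l > 0" and dvd: "\<And>l. N l dvd N (Suc l)" and "j > 0"
  shows "steinitz_type (steinitz_lcm {N l | l. l > 0})
       = steinitz_type (steinitz_lcm {N l div gcd (N l) j | l. l > 0})"
proof -
  let ?g = "\<lambda>l. gcd (N l) j" and ?M = "\<lambda>l. N l div gcd (N l) j"
  have g_step: "?g l dvd ?g (l + k)" for l k
  proof (induction k)
    case (Suc k)
    have "?g (l + k) dvd ?g (Suc (l + k))"
      by (intro gcd_mono dvd dvd_refl)
    with Suc show ?case by (metis add_Suc_right dvd_trans)
  qed simp
  have g_le: "?g l \<le> j" for l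
    using \<open>j > 0\<close> by (simp add: gcd_le2_nat)
  then have "finite (range ?g)"
    by (intro finite_subset[OF _ finite_atMost[of j]] image_subsetI) simp
  then have "Max (range ?g) \<in> range ?g" by (intro Max_in) simp_all
  then obtain L where L: "Max (range ?g) = ?g L" by (elim imageE)
  \<comment> \<open>The value at \<open>L\<close> is maximal, which gives one inequality;
    divisibility along the sequence gives the other.\<close>
  have g_const: "?g l = ?g L" if "l > L" for l
  proof (rule antisym)
    show "?g l \<le> ?g L" unfolding L[symmetric] using \<open>finite (range ?g)\<close> by (intro Max_ge) auto
    show "?g L \<le> ?g l"
      using g_step[of L "l - L"] that pos[of l] by (intro dvd_imp_le) auto
  qed
  define d where "d = ?g L"
  have "d \<noteq> 0" unfolding d_def using \<open>j > 0\<close> by simp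
  have M_pos: "?M l > 0" for l
    using pos[of l] dvd_mult_div_cancel[of "?g l" "N l"] by (intro Nat.gr0I) simp
  \<comment> \<open>\<open>?M l\<close> divides exactly those \<open>k\<close> for which
    \<open>N l\<close> divides \<open>j * k\<close>, so divisibility passes from \<open>N\<close> to
    \<open>?M\<close> without comparing quotients.\<close>
  have M_dvd: "?M l dvd ?M (Suc l)" for l
  proof -
    have "N (Suc l) dvd j * ?M (Suc l)"
      using div_gcd_dvd_iff[OF \<open>j > 0\<close>, of "N (Suc l)" "?M (Suc l)"] by simp
    with dvd[of l] have "N l dvd j * ?M (Suc l)" by (rule dvd_trans)
    then show ?thesis using div_gcd_dvd_iff[OF \<open>j > 0\<close>] by simp
  qed
  have "{N l | l. l > L} = (*) d ` {?M l | l. l > L}"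
  proof -
    have "N l = d * ?M l" if "l > L" for l
      using g_const[OF that] unfolding d_def by (metis dvd_mult_div_cancel gcd_dvd1)
    then have "N ` {L<..} = (*) d ` ?M ` {L<..}"
      unfolding image_image by (intro image_cong refl) simp
    then show ?thesis unfolding image_Collect greaterThan_def by simp
  qed
  moreover have "{?M l | l. l > L} \<noteq> {}" by blast
  moreover have "0 \<notin> {?M l | l. l > L}" using M_pos by (auto simp del: div_greater_zero_iff)
  ultimately have "steinitz_type (steinitz_lcm {N l | l. l > L})
      = steinitz_type (steinitz_lcm {?M l | l. l > L})"
    using \<open>d \<noteq> 0\<close> by (simp add: steinitz_lcm_mult steinitz_type_mult_of_nat)
  moreover have "steinitz_lcm {?M l | l. l > 0} = steinitz_lcm {?M l | l. l > L}"
    using M_pos M_dvd by (rule steinitz_lcm_tail[where N = ?M])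
  ultimately show ?thesis
    using steinitz_lcm_tail[where N = N and L = L, OF pos dvd] by simp
qed

text \<open>The quotient is cyclic, generated by the coset of \<open>\<gamma>\<close>, so
  \<open>n\<close> is the order of that coset. The positive power in \<open>C\<close> excludes an
  infinite quotient, whose \<open>order\<close> would be 0.\<close>

lemma (in group) order_cyclic_quotient:
  assumes \<gamma>: "\<gamma> \<in> carrier G" and C: "subgroup C G" and k: "\<gamma> [^] (k::nat) \<in> C" "k > 0"
  defines "n \<equiv> order (G\<lparr>carrier := generate G {\<gamma>}\<rparr> Mod (generate G {\<gamma>} \<inter> C))"
  shows "n > 0" and "\<gamma> [^] (i::nat) \<in> C \<longleftrightarrow> n dvd i"
proof -
  define Z where "Z = generate G {\<gamma>}"
  define K where "K = G\<lparr>carrier := Z\<rparr>"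
  define M where "M = Z \<inter> C"
  have Z: "subgroup Z G" unfolding Z_def using \<gamma> by (intro generate_is_subgroup) auto
  interpret K: group K unfolding K_def by (rule subgroup_imp_group[OF Z])
  have Z_pow: "Z = {\<gamma> [^] (i::int) | i. i \<in> UNIV}"
    unfolding Z_def by (rule generate_pow[OF \<gamma>])
  \<comment> \<open>A cyclic group is abelian, so \<open>M\<close> is normal in it even when
    \<open>C\<close> is not normal in the whole group.\<close>
  interpret K: comm_group K
    by (rule K.group_comm_groupI)
      (auto simp: K_def Z_pow \<gamma> add.commute simp flip: int_pow_mult)
  have "subgroup M K"
    unfolding M_def K_def
    using subgroups_Inter_pair[OF Z C] Z subgroup_incl by auto
  interpret M: normal M K
    using \<open>subgroup M K\<close> by (rule K.subgroup_imp_normal)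
  interpret Q: group "K Mod M" by (rule M.factorgroup_is_group)
  have \<gamma>K: "\<gamma> \<in> carrier K" unfolding K_def Z_def by (simp add: generate.incl)
  define c where "c = M #>\<^bsub>K\<^esub> \<gamma>"
  have c: "c \<in> carrier (K Mod M)" unfolding c_def carrier_FactGroup using \<gamma>K by blast
  have pow: "c [^]\<^bsub>K Mod M\<^esub> i = \<one>\<^bsub>K Mod M\<^esub> \<longleftrightarrow> \<gamma> [^] i \<in> C" for i :: nat
  proof -
    have *: "\<gamma> [^]\<^bsub>K\<^esub> i = \<gamma> [^] i" unfolding K_def by (simp flip: nat_pow_consistent)
    have "\<gamma> [^]\<^bsub>K\<^esub> i \<in> carrier K" using \<gamma>K by simp
    then have "M #>\<^bsub>K\<^esub> (\<gamma> [^]\<^bsub>K\<^esub> i) = M \<longleftrightarrow> \<gamma> [^]\<^bsub>K\<^esub> i \<in> M"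
      by (metis K.coset_join1 K.coset_join2 M.subgroup_axioms M.subset)
    also have "\<dots> \<longleftrightarrow> \<gamma> [^] i \<in> C"
      using \<open>\<gamma> [^]\<^bsub>K\<^esub> i \<in> carrier K\<close> unfolding * M_def by (simp add: K_def)
    finally show ?thesis
      unfolding c_def by (simp add: M.FactGroup_pow[OF \<gamma>K])
  qed
  have "carrier (K Mod M) = generate (K Mod M) {c}"
  proof -
    have "carrier (K Mod M) = (\<lambda>x. M #>\<^bsub>K\<^esub> x) ` {\<gamma> [^]\<^bsub>K\<^esub> (i::int) | i. i \<in> UNIV}"
    proof -
      have *: "\<gamma> [^]\<^bsub>K\<^esub> (i::int) = \<gamma> [^] i" for i
        using int_pow_consistent[OF Z] \<gamma>K unfolding K_def by simp
      have "carrier K = Z" unfolding K_def by simp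
      then have "carrier K = {\<gamma> [^]\<^bsub>K\<^esub> (i::int) | i. i \<in> UNIV}"
        unfolding * Z_pow .
      then show ?thesis unfolding carrier_FactGroup by (rule arg_cong)
    qed
    also have "\<dots> = {c [^]\<^bsub>K Mod M\<^esub> (i::int) | i. i \<in> UNIV}"
      unfolding c_def M.FactGroup_int_pow[OF \<gamma>K] by blast
    finally show ?thesis by (simp add: Q.generate_pow[OF c])
  qed
  then have n: "n = Q.ord c"
    using Q.generate_pow_card[OF c] unfolding n_def order_def K_def M_def Z_def by simp
  show "\<gamma> [^] i \<in> C \<longleftrightarrow> n dvd i"
    unfolding n using Q.pow_eq_id[OF c, of i] pow by simp
  show "n > 0"
    unfolding n using Q.pow_eq_id[OF c, of k] pow[of k] k by (auto intro!: Nat.gr0I)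
qed

section \<open>Separating sequences of clopen partitions\<close>

text \<open>A partition is encoded by a labelling map; continuity into a discrete space says that
  its fibres are clopen.\<close>

definition separating :: "'x topology \<Rightarrow> (nat \<Rightarrow> 'x \<Rightarrow> 'a) \<Rightarrow> bool" where
  "separating X s \<longleftrightarrow>
     (\<forall>l. continuous_map X (discrete_topology UNIV) (s l)) \<and>
     (\<forall>l. \<forall>x\<in>topspace X. \<forall>y\<in>topspace X. s (Suc l) x = s (Suc l) y \<longrightarrow> s l x = s l y) \<and>
     (\<forall>x\<in>topspace X. \<forall>y\<in>topspace X. (\<forall>l. s l x = s l y) \<longrightarrow> x = y)"

lemma separating_subtopology: "separating X s \<Longrightarrow> separating (subtopology X U) s"
  by (auto simp: separating_def continuous_map_from_subtopology)

lemma separating_pullback: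
  assumes "separating Y s" and "homeomorphic_map X Y f"
  shows "separating X (\<lambda>l x. s l (f x))"
proof -
  have f: "continuous_map X Y f" "inj_on f (topspace X)" "f ` topspace X = topspace Y"
    using assms(2) by (auto simp: homeomorphic_eq_everything_map)
  have cont: "continuous_map X (discrete_topology UNIV) (\<lambda>x. s l (f x))" for l
    using continuous_map_compose[OF f(1), of "discrete_topology UNIV" "s l"] assms(1)
    by (simp add: separating_def o_def)
  have mem: "f x \<in> topspace Y" if "x \<in> topspace X" for x
    using that f(3) by blast
  have inj: "x = y" if "x \<in> topspace X" "y \<in> topspace X" "\<forall>l. s l (f x) = s l (f y)" for x y
    using that assms(1) mem inj_onD[OF f(2)] unfolding separating_def by blast
  show ?thesis
    using assms(1) mem cont inj unfolding separating_def by blast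
qed

text \<open>Every set of label pairs is closed in the discrete topology, so this covers both
  equality and inequality of labels.\<close>

lemma closedin_discrete_pair:
  assumes "continuous_map X (discrete_topology UNIV) f"
  shows "closedin (prod_topology X X)
           {z \<in> topspace (prod_topology X X). P (f (fst z)) (f (snd z))}"
proof -
  have "continuous_map (prod_topology X X) (discrete_topology UNIV) (\<lambda>z. (f (fst z), f (snd z)))"
  proof -
    have "continuous_map (prod_topology X X)
        (prod_topology (discrete_topology UNIV) (discrete_topology UNIV)) (\<lambda>z. (f (fst z), f (snd z)))"
      using continuous_map_compose[OF continuous_map_fst[of X X] assms]
        continuous_map_compose[OF continuous_map_snd[of X X] assms]
      by (simp add: continuous_map_pairwise o_def)
    then show ?thesis by (simp flip: prod_topology_discrete_topology)
  qed
  from closedin_continuous_map_preimage[OF this, of "{(a, b). P a b}"]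
  show ?thesis by simp
qed

text \<open>The pairs with equal \<open>s l\<close>-labels but different \<open>f\<close>-values
  form decreasing closed subsets \<open>K l\<close> of the compact square. Separation of points
  makes their intersection empty, so some \<open>K l\<close> is empty.\<close>

lemma separating_refines:
  assumes "compact_space X" and s: "separating X s"
    and f: "continuous_map X (discrete_topology UNIV) f"
  obtains l where "\<And>x y. x \<in> topspace X \<Longrightarrow> y \<in> topspace X \<Longrightarrow> s l x = s l y \<Longrightarrow> f x = f y"
proof -
  define P where "P = topspace (prod_topology X X)"
  define K where "K l = {z\<in>P. s l (fst z) = s l (snd z)} \<inter> {z\<in>P. f (fst z) \<noteq> f (snd z)}" for l
  have closed: "closedin (prod_topology X X) (K l)" for l
    unfolding K_def P_def using s f
    by (intro closedin_Int closedin_discrete_pair) (auto simp: separating_def)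
  have "decseq K"
  proof (rule decseq_SucI)
    fix l
    have "s l x = s l y" if "(x, y) \<in> P" "s (Suc l) x = s (Suc l) y" for x y
      using s that unfolding separating_def P_def by auto
    then show "K (Suc l) \<subseteq> K l" unfolding K_def by fastforce
  qed
  have "(\<Inter>l. K l) = {}"
  proof -
    have "x = y" if "(x, y) \<in> (\<Inter>l. K l)" for x y
    proof -
      have "x \<in> topspace X" "y \<in> topspace X" "\<forall>l. s l x = s l y"
        using that by (auto simp: K_def P_def)
      then show ?thesis using s unfolding separating_def by blast
    qed
    then show ?thesis by (fastforce simp: K_def)
  qed
  moreover have "compact_space (prod_topology X X)"
    using assms(1) by (simp add: compact_space_prod_topology)
  ultimately obtain l where "K l = {}"
    using compact_space_imp_nest[OF _ closed _ \<open>decseq K\<close>] by blast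
  show thesis
  proof (rule that, rule ccontr)
    fix x y assume "x \<in> topspace X" "y \<in> topspace X" "s l x = s l y" "f x \<noteq> f y"
    then have "(x, y) \<in> K l" by (simp add: K_def P_def)
    with \<open>K l = {}\<close> show False by simp
  qed
qed

text \<open>When \<open>f\<close> permutes the fibres of \<open>q\<close>, this set consists of the multiples of the order of that
  permutation, so its \<open>Gcd\<close> is the order; it is \<open>0\<close> if the order is infinite.\<close>

definition period :: "'x set \<Rightarrow> ('x \<Rightarrow> 'a) \<Rightarrow> ('x \<Rightarrow> 'x) \<Rightarrow> nat" where
  "period U q f = Gcd {k. \<forall>x\<in>U. q ((f ^^ k) x) = q x}"

definition steinitz_period :: "'x set \<Rightarrow> (nat \<Rightarrow> 'x \<Rightarrow> 'a) \<Rightarrow> ('x \<Rightarrow> 'x) \<Rightarrow> steinitz" where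
  "steinitz_period U s f = steinitz_lcm {period U (s l) f | l. l > 0}"

section \<open>Independence of the period from the separating sequence\<close>

lemma funpow_closed: "f ` U \<subseteq> U \<Longrightarrow> x \<in> U \<Longrightarrow> (f ^^ k) x \<in> U"
  by (induction k) auto

text \<open>By compactness some partition of \<open>s\<close> refines a given one of
  \<open>t\<close>. An iterate of \<open>f\<close> preserving the finer labels preserves the coarser
  ones, so the periods divide each other accordingly.\<close>

lemma steinitz_period_le:
  assumes "compact_space X" "separating X s" "separating X t"
    and f: "f ` topspace X \<subseteq> topspace X"
    and pos: "\<And>l. period (topspace X) (s l) f > 0"
  shows "steinitz_period (topspace X) t f \<le> steinitz_period (topspace X) s f"
  unfolding steinitz_period_def
proof (rule steinitz_lcm_mono)
  fix a assume "a \<in> {period (topspace X) (t l) f | l. l > 0}"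
  then obtain l where a: "a = period (topspace X) (t l) f" by blast
  have "continuous_map X (discrete_topology UNIV) (t l)"
    using assms(3) unfolding separating_def by blast
  then obtain m where
    m: "\<And>x y. x \<in> topspace X \<Longrightarrow> y \<in> topspace X \<Longrightarrow> s m x = s m y \<Longrightarrow> t l x = t l y"
    using separating_refines[OF assms(1,2), of "t l"] by metis
  \<comment> \<open>The least common multiple runs over positive indices, hence the passage from
    \<open>m\<close> to the finer \<open>Suc m\<close>.\<close>
  have "t l x = t l y" if "x \<in> topspace X" "y \<in> topspace X" "s (Suc m) x = s (Suc m) y" for x y
    using that assms(2) m unfolding separating_def by blast
  then have "{k. \<forall>x\<in>topspace X. s (Suc m) ((f ^^ k) x) = s (Suc m) x}
      \<subseteq> {k. \<forall>x\<in>topspace X. t l ((f ^^ k) x) = t l x}"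
    using funpow_closed[OF f] by blast
  then have "a dvd period (topspace X) (s (Suc m)) f"
    unfolding a period_def by (intro Gcd_greatest Gcd_dvd) blast
  then show "\<exists>b\<in>{period (topspace X) (s l) f | l. l > 0}. b \<noteq> 0 \<and> a dvd b"
    using pos[of "Suc m"] by (intro bexI[of _ "period (topspace X) (s (Suc m)) f"]) auto
qed

text \<open>Pulled back along \<open>\<phi>\<close>, the labels \<open>t\<close> have the same
  periods under \<open>f\<close> as before under \<open>f'\<close>. Two separating sequences on the
  same compact space are then compared in both directions.\<close>

lemma steinitz_period_conjugate:
  assumes "compact_space X" "separating X s" "separating Y t"
    and \<phi>: "homeomorphic_map X Y \<phi>"
    and f: "f ` topspace X \<subseteq> topspace X"
    and conj: "\<And>x. x \<in> topspace X \<Longrightarrow> \<phi> (f x) = f' (\<phi> x)"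
    and pos: "\<And>l. period (topspace X) (s l) f > 0" "\<And>l. period (topspace Y) (t l) f' > 0"
  shows "steinitz_period (topspace X) s f = steinitz_period (topspace Y) t f'"
proof -
  define t' where "t' l x = t l (\<phi> x)" for l x
  have "\<phi> ((f ^^ k) x) = (f' ^^ k) (\<phi> x)" if "x \<in> topspace X" for k x
    by (induction k) (simp_all add: conj funpow_closed[OF f that])
  moreover have "\<phi> ` topspace X = topspace Y"
    using \<phi> by (simp add: homeomorphic_imp_surjective_map)
  ultimately have period: "period (topspace Y) (t l) f' = period (topspace X) (t' l) f" for l
    unfolding period_def t'_def by (simp flip: \<open>\<phi> ` topspace X = topspace Y\<close> cong: ball_cong)
  have "separating X t'"
    unfolding t'_def using assms(3) \<phi> by (rule separating_pullback)
  moreover have "steinitz_period (topspace Y) t f' = steinitz_period (topspace X) t' f"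
    unfolding steinitz_period_def period ..
  ultimately show ?thesis
    using steinitz_period_le[OF assms(1) \<open>separating X t'\<close> assms(2) f]
      steinitz_period_le[OF assms(1,2) \<open>separating X t'\<close> f] pos
    by (simp add: period order.antisym)
qed

section \<open>Cosets and restricted cores\<close>

context group
begin

lemma lcoset_eq_iff:
  assumes "subgroup K G" "a \<in> carrier G" "b \<in> carrier G"
  shows "a <# K = b <# K \<longleftrightarrow> inv b \<otimes> a \<in> K"
proof
  assume "a <# K = b <# K"
  with assms have "a \<in> b <# K" using lcos_self by blast
  with assms show "inv b \<otimes> a \<in> K"
    by (metis is_group subgroup.lcos_module_imp)
next
  assume "inv b \<otimes> a \<in> K"
  with assms have "a \<in> b <# K"
    by (metis is_group subgroup.lcos_module_rev)
  with assms show "a <# K = b <# K"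
    by (metis l_repr_independence)
qed

lemma lcoset_in_lcosets: "a \<in> carrier G \<Longrightarrow> a <# K \<in> lcosets K"
  unfolding LCOSETS_def by blast

lemma lcoset_translate:
  assumes "subgroup K G" "a \<in> carrier G" "b \<in> carrier G"
  shows "a <# (b <# K) = (a \<otimes> b) <# K"
  using assms by (simp add: lcos_m_assoc subgroup.subset)

text \<open>A conjugate of \<open>K\<close> is a point stabiliser for the left action on the cosets
  of \<open>K\<close>.\<close>

lemma mem_conjugate_iff:
  assumes K: "subgroup K G" and a: "a \<in> carrier G" and d: "\<delta> \<in> carrier G"
  shows "a \<in> (\<lambda>x. \<delta> \<otimes> x \<otimes> inv \<delta>) ` K \<longleftrightarrow> a <# (\<delta> <# K) = \<delta> <# K"
proof -
  have "a \<in> (\<lambda>x. \<delta> \<otimes> x \<otimes> inv \<delta>) ` K \<longleftrightarrow> inv \<delta> \<otimes> (a \<otimes> \<delta>) \<in> K"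
  proof
    assume "a \<in> (\<lambda>x. \<delta> \<otimes> x \<otimes> inv \<delta>) ` K"
    then obtain x where x: "x \<in> K" "a = \<delta> \<otimes> x \<otimes> inv \<delta>" by blast
    have "x \<in> carrier G" using x K by (simp add: subgroup.mem_carrier)
    then have "inv \<delta> \<otimes> (a \<otimes> \<delta>) = x"
      unfolding x(2) using d by (simp add: m_assoc inv_solve_left')
    with x show "inv \<delta> \<otimes> (a \<otimes> \<delta>) \<in> K" by simp
  next
    assume *: "inv \<delta> \<otimes> (a \<otimes> \<delta>) \<in> K"
    have "\<delta> \<otimes> (inv \<delta> \<otimes> (a \<otimes> \<delta>)) \<otimes> inv \<delta> = a"
      using a d by (simp add: inv_solve_right' flip: m_assoc)
    with * show "a \<in> (\<lambda>x. \<delta> \<otimes> x \<otimes> inv \<delta>) ` K" by force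
  qed
  then show ?thesis
    using assms by (simp add: lcoset_translate lcoset_eq_iff)
qed

lemma subgroup_conjugate:
  assumes "subgroup K G" "\<delta> \<in> carrier G"
  shows "subgroup ((\<lambda>x. \<delta> \<otimes> x \<otimes> inv \<delta>) ` K) G"
proof -
  have "(\<delta> \<otimes> x \<otimes> inv \<delta>) \<otimes> (\<delta> \<otimes> y \<otimes> inv \<delta>) = \<delta> \<otimes> (x \<otimes> y) \<otimes> inv \<delta>"
    if "x \<in> carrier G" "y \<in> carrier G" for x y
  proof -
    have "inv \<delta> \<otimes> (\<delta> \<otimes> (y \<otimes> inv \<delta>)) = y \<otimes> inv \<delta>"
      using that assms(2) by (simp flip: m_assoc)
    then show ?thesis using that assms(2) by (simp add: m_assoc)
  qed
  then have "(\<lambda>x. \<delta> \<otimes> x \<otimes> inv \<delta>) \<in> hom G G"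
    using assms(2) by (intro homI) simp_all
  then show ?thesis
    using group_hom.subgroup_img_is_subgroup[OF _ assms(1)] is_group
    by (metis group_hom.intro group_hom_axioms.intro)
qed

lemma subgroup_restricted_core:
  assumes "subgroup (C l) G" "subgroup H G"
  shows "subgroup (restricted_core G C H l) G"
  unfolding restricted_core_def
  using assms subgroup.one_closed[OF assms(2)]
  by (intro subgroups_Inter) (auto intro: subgroup_conjugate subgroup.mem_carrier)

lemma mem_restricted_core_iff:
  assumes "subgroup (C l) G" "subgroup H G" "a \<in> carrier G"
  shows "a \<in> restricted_core G C H l \<longleftrightarrow> (\<forall>\<delta>\<in>H. a <# (\<delta> <# C l) = \<delta> <# C l)"
  using assms mem_conjugate_iff[of "C l" a] subgroup.mem_carrier[OF assms(2)]
  unfolding restricted_core_def by blast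

text \<open>Left multiplication by \<open>\<gamma>\<close> permutes \<open>n\<close> cosets in
  cycles of length at most \<open>n\<close>, so the exponent \<open>fact n\<close> works for all
  cosets at once.\<close>

lemma pow_fixes_lcosets:
  assumes K: "finite_index_subgroup K G" and \<gamma>: "\<gamma> \<in> carrier G"
  shows "\<exists>k::nat. k > 0 \<and> (\<forall>\<delta>\<in>carrier G. \<gamma> [^] k <# (\<delta> <# K) = \<delta> <# K)"
proof -
  define n where "n = card (lcosets K)"
  have fin: "finite (lcosets K)" and sub: "subgroup K G"
    using K by (auto simp: finite_index_subgroup_def)
  have "\<gamma> [^] (fact n :: nat) <# (\<delta> <# K) = \<delta> <# K" if \<delta>: "\<delta> \<in> carrier G" for \<delta>
  proof -
    let ?f = "\<lambda>i::nat. (\<gamma> [^] i \<otimes> \<delta>) <# K"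
    have "?f ` {..n} \<subseteq> lcosets K"
      using \<gamma> \<delta> by (intro image_subsetI lcoset_in_lcosets) simp
    then have "card (?f ` {..n}) \<le> n"
      unfolding n_def using fin by (rule card_mono[rotated])
    \<comment> \<open>Pigeonhole: \<open>{..n}\<close> has \<open>n + 1\<close> elements, but there
      are only \<open>n\<close> cosets.\<close>
    then have "\<not> inj_on ?f {..n}"
      using card_image[of ?f "{..n}"] by auto
    then obtain i j where ij: "i < j" "j \<le> n" "?f i = ?f j"
      unfolding inj_on_def by (metis atMost_iff linorder_neqE_nat)
    define m where "m = j - i"
    have m: "0 < m" "m \<le> n" "j = i + m" using ij unfolding m_def by auto
    have fix_m: "\<gamma> [^] m <# (\<delta> <# K) = \<delta> <# K"
    proof -
      have "\<gamma> [^] i <# (\<gamma> [^] m <# (\<delta> <# K)) = \<gamma> [^] i <# (\<delta> <# K)"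
        using ij(3) \<gamma> \<delta> sub unfolding m(3)
        by (simp add: lcoset_translate m_assoc flip: nat_pow_mult)
      then have "inv (\<gamma> [^] i) <# (\<gamma> [^] i <# (\<gamma> [^] m <# (\<delta> <# K)))
          = inv (\<gamma> [^] i) <# (\<gamma> [^] i <# (\<delta> <# K))" by simp
      then show ?thesis
        using \<gamma> \<delta> sub by (simp add: lcoset_translate flip: m_assoc)
    qed
    have "\<gamma> [^] (m * q) <# (\<delta> <# K) = \<delta> <# K" for q
    proof (induction q)
      case 0
      show ?case using \<delta> sub by (simp add: lcoset_translate)
    next
      case (Suc q)
      have "\<gamma> [^] (m * Suc q) = \<gamma> [^] (m * q) \<otimes> \<gamma> [^] m"
        using \<gamma> by (simp add: nat_pow_mult add.commute)
      then have "\<gamma> [^] (m * Suc q) <# (\<delta> <# K) = \<gamma> [^] (m * q) <# (\<gamma> [^] m <# (\<delta> <# K))"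
        using \<gamma> \<delta> sub by (simp add: lcoset_translate m_assoc)
      with Suc show ?case by (simp add: fix_m)
    qed
    moreover have "m dvd fact n" using m by (intro dvd_fact) auto
    ultimately show ?thesis by (metis dvd_def)
  qed
  then show ?thesis by (intro exI[of _ "fact n"]) simp
qed

text \<open>Serves both for projecting cosets of \<open>K\<close> to cosets of \<open>H\<close> and
  for the coherence of the trivial cosets in the inverse limit.\<close>

lemma subgroup_set_mult_supergroup:
  assumes "subgroup K G" "subgroup H G" "K \<subseteq> H"
  shows "K <#> H = H"
proof
  show "K <#> H \<subseteq> H"
    using assms(3) subgroup.m_closed[OF assms(2)] unfolding set_mult_def by blast
  show "H \<subseteq> K <#> H"
  proof
    fix y assume "y \<in> H"
    then have "y = \<one> \<otimes> y" using subgroup.mem_carrier[OF assms(2)] by simp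
    then show "y \<in> K <#> H"
      using \<open>y \<in> H\<close> subgroup.one_closed[OF assms(1)] unfolding set_mult_def by blast
  qed
qed

text \<open>Right multiplication by \<open>H\<close> maps the finitely many cosets of
  \<open>K\<close> onto those of \<open>H\<close>.\<close>

lemma finite_index_supergroup:
  assumes K: "finite_index_subgroup K G" and "subgroup H G" "K \<subseteq> H"
  shows "finite_index_subgroup H G"
proof -
  have K': "subgroup K G" using K by (simp add: finite_index_subgroup_def)
  have "lcosets H \<subseteq> (\<lambda>A. A <#> H) ` (lcosets K)"
  proof
    fix B assume "B \<in> lcosets H"
    then obtain a where a: "a \<in> carrier G" "B = a <# H" unfolding LCOSETS_def by blast
    have "B = (a <# K) <#> H"
      using a K' assms(2,3) by (simp add: a(2) subgroup_set_mult_supergroup setmult_lcos_assoc subgroup.subset)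
    then show "B \<in> (\<lambda>A. A <#> H) ` (lcosets K)"
      using a(1) unfolding LCOSETS_def by blast
  qed
  then show ?thesis
    using assms(2) K finite_surj unfolding finite_index_subgroup_def by blast
qed

end

section \<open>Return subgroups of a modelled odometer\<close>

text \<open>Fixes a model together with an adapted set; it is interpreted once for each of the two
  odometers.\<close>

locale modelled_odometer = group_action \<Gamma> "topspace X" \<Phi>
  for \<Gamma> (structure) and X :: "'x topology" and \<Phi> +
  fixes C :: "nat \<Rightarrow> 'g set" and h :: "'x \<Rightarrow> nat \<Rightarrow> 'g set" and U :: "'x set"
  assumes compact: "compact_space X"
    and homeo: "g \<in> carrier \<Gamma> \<Longrightarrow> homeomorphic_map X X (\<Phi> g)"
    and minimal: "minimal_action X \<Gamma> \<Phi>"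
    and chain: "group_chain \<Gamma> C"
    and model: "homeomorphic_map X (chain_limit \<Gamma> C) h"
    and equivariant: "\<lbrakk>g \<in> carrier \<Gamma>; x \<in> topspace X\<rbrakk> \<Longrightarrow> h (\<Phi> g x) = chain_action \<Gamma> g (h x)"
    and adapted: "adapted X \<Gamma> \<Phi> U"
begin

section \<open>Coset coordinates of a group chain model\<close>

sublocale group \<Gamma>
  using group_hom by (simp add: group_hom_def)

lemma subgroup_chain: "subgroup (C l) \<Gamma>" and finite_index_chain: "finite_index_subgroup (C l) \<Gamma>"
  and chain_Suc: "C (Suc l) \<subseteq> C l"
  using chain by (auto simp: group_chain_def finite_index_subgroup_def)

lemma act_closed: "\<lbrakk>g \<in> carrier \<Gamma>; x \<in> topspace X\<rbrakk> \<Longrightarrow> \<Phi> g x \<in> topspace X"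
  using surj_prop by blast

lemma act_inv: "\<lbrakk>g \<in> carrier \<Gamma>; x \<in> topspace X\<rbrakk> \<Longrightarrow> \<Phi> (inv g) (\<Phi> g x) = x"
  by (simp add: orbit_sym_aux)

lemma act_one: "x \<in> topspace X \<Longrightarrow> \<Phi> \<one> x = x"
  by (metis id_eq_one restrict_apply)

lemma equivariant_component:
  "\<lbrakk>g \<in> carrier \<Gamma>; x \<in> topspace X\<rbrakk> \<Longrightarrow> h (\<Phi> g x) l = g <# h x l"
  by (simp add: equivariant chain_action_def)

lemma chain_limit_topspace:
  "topspace (chain_limit \<Gamma> C) = {c. (\<forall>l. c l \<in> lcosets (C l)) \<and> (\<forall>l. c l = c (Suc l) <#> C l)}"
  by (auto simp: chain_limit_def topspace_subtopology PiE_iff)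

lemma model_mem: "x \<in> topspace X \<Longrightarrow> h x \<in> topspace (chain_limit \<Gamma> C)"
  using homeomorphic_imp_surjective_map[OF model] by blast

lemma model_bonding: "x \<in> topspace X \<Longrightarrow> h x l = h x (Suc l) <#> C l"
  using model_mem unfolding chain_limit_topspace by blast

text \<open>The three clauses come from continuity of \<open>h\<close> into the product, from the
  bonding maps, and from injectivity of \<open>h\<close>.\<close>

lemma separating_model: "separating X (\<lambda>l x. h x l)"
  unfolding separating_def
proof (intro conjI allI ballI impI)
  fix l
  have "continuous_map X (chain_limit \<Gamma> C) h"
    using model by (rule homeomorphic_imp_continuous_map)
  then have "continuous_map X (product_topology (\<lambda>l. discrete_topology (lcosets (C l))) UNIV) h"
    unfolding chain_limit_def by (rule continuous_map_into_fulltopology)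
  then have "continuous_map X (discrete_topology (lcosets (C l))) (\<lambda>x. h x l)"
    by (simp add: continuous_map_componentwise_UNIV)
  then show "continuous_map X (discrete_topology UNIV) (\<lambda>x. h x l)"
    by (metis continuous_map_into_fulltopology inf_top_left subtopology_discrete_topology)
next
  fix l x y assume "x \<in> topspace X" "y \<in> topspace X" "h x (Suc l) = h y (Suc l)"
  then show "h x l = h y l" using model_bonding[of _ l] by metis
next
  fix x y assume xy: "x \<in> topspace X" "y \<in> topspace X" and eq: "\<forall>l. h x l = h y l"
  from eq have "h x = h y" by (simp add: fun_eq_iff)
  moreover have "inj_on h (topspace X)"
    using model by (rule homeomorphic_imp_injective_map)
  ultimately show "x = y" using xy by (simp add: inj_onD)
qed

text \<open>The chain itself, read as the sequence of trivial cosets, is a point of the inverse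
  limit, and \<open>h\<close> is onto.\<close>

lemma basepoint_exists: "\<exists>x\<in>topspace X. h x = C"
proof -
  have "C l \<in> lcosets (C l)" for l
    using lcoset_in_lcosets[of \<one> "C l"] subgroup_chain
    by (simp add: lcos_mult_one subgroup.subset)
  moreover have "C l = C (Suc l) <#> C l" for l
    by (rule subgroup_set_mult_supergroup[OF subgroup_chain subgroup_chain chain_Suc, symmetric])
  ultimately have "C \<in> topspace (chain_limit \<Gamma> C)" unfolding chain_limit_topspace by blast
  then show ?thesis using homeomorphic_imp_surjective_map[OF model] by (metis imageE)
qed

lemma orbit_meets_open:
  assumes "x \<in> topspace X" "openin X V" "V \<noteq> {}"
  obtains g where "g \<in> carrier \<Gamma>" "\<Phi> g x \<in> V"
proof -
  obtain y where "y \<in> V" using assms(3) by blast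
  moreover have "y \<in> X closure_of (orbit \<Gamma> \<Phi> x)"
    using minimal assms openin_subset[OF assms(2)] \<open>y \<in> V\<close>
    unfolding minimal_action_def by auto
  ultimately show thesis
    using assms(2) that unfolding in_closure_of orbit_def by blast
qed

section \<open>The adapted set and its return subgroup\<close>

lemma U_nonempty: "U \<noteq> {}" and U_open: "openin X U" and U_closed: "closedin X U"
  and U_subset: "U \<subseteq> topspace X"
  using adapted by (auto simp: adapted_def openin_subset)

text \<open>A translate of an adapted set that meets the set equals it, so any single point of
  \<open>U\<close> decides membership.\<close>

lemma mem_return_subgroup_iff:
  assumes "y \<in> U" "a \<in> carrier \<Gamma>"
  shows "a \<in> return_subgroup \<Gamma> \<Phi> U \<longleftrightarrow> \<Phi> a y \<in> U"
  using assms adapted unfolding return_subgroup_def adapted_def by blast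

lemma return_subgroup_image: "a \<in> return_subgroup \<Gamma> \<Phi> U \<Longrightarrow> \<Phi> a ` U = U"
  using adapted unfolding return_subgroup_def adapted_def by blast

lemma return_subgroup_carrier: "a \<in> return_subgroup \<Gamma> \<Phi> U \<Longrightarrow> a \<in> carrier \<Gamma>"
  by (simp add: return_subgroup_def)

text \<open>At this point the level \<open>l\<close> coordinate of \<open>\<Phi> g x0\<close> is
  simply the coset \<open>g <# C l\<close>.\<close>

definition x0 where "x0 = (SOME x. x \<in> topspace X \<and> h x = C)"

lemma x0: "x0 \<in> topspace X" "h x0 = C"
  using someI_ex[of "\<lambda>x. x \<in> topspace X \<and> h x = C"] basepoint_exists unfolding x0_def by blast+

definition g0 where "g0 = (SOME g. g \<in> carrier \<Gamma> \<and> \<Phi> g x0 \<in> U)"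

lemma g0: "g0 \<in> carrier \<Gamma>" "\<Phi> g0 x0 \<in> U"
proof -
  have "\<exists>g. g \<in> carrier \<Gamma> \<and> \<Phi> g x0 \<in> U"
    using orbit_meets_open[OF x0(1) U_open U_nonempty] by metis
  from someI_ex[OF this] show "g0 \<in> carrier \<Gamma>" "\<Phi> g0 x0 \<in> U" unfolding g0_def by blast+
qed

text \<open>The base point \<open>x0\<close> of the chain need not lie in \<open>U\<close>, so \<open>H\<close> is the return subgroup not of \<open>U\<close>
  but of its translate by \<open>inv g0\<close>, which contains \<open>x0\<close>.\<close>

definition H where "H = {\<gamma> \<in> carrier \<Gamma>. g0 \<otimes> \<gamma> \<otimes> inv g0 \<in> return_subgroup \<Gamma> \<Phi> U}"

lemma H_carrier: "\<gamma> \<in> H \<Longrightarrow> \<gamma> \<in> carrier \<Gamma>"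
  by (simp add: H_def)

text \<open>Membership is tested at the point \<open>\<Phi> g0 x0\<close> of \<open>U\<close>, where
  the trailing \<open>inv g0\<close> cancels.\<close>

lemma mem_H_iff:
  assumes "\<gamma> \<in> carrier \<Gamma>"
  shows "\<gamma> \<in> H \<longleftrightarrow> \<Phi> (g0 \<otimes> \<gamma>) x0 \<in> U"
proof -
  have "\<gamma> \<in> H \<longleftrightarrow> \<Phi> (g0 \<otimes> \<gamma> \<otimes> inv g0) (\<Phi> g0 x0) \<in> U"
    using assms g0 by (simp add: H_def mem_return_subgroup_iff)
  also have "\<Phi> (g0 \<otimes> \<gamma> \<otimes> inv g0) (\<Phi> g0 x0) = \<Phi> (g0 \<otimes> \<gamma>) x0"
    using assms g0 x0 by (simp add: composition_rule act_closed act_inv)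
  finally show ?thesis .
qed

lemma subgroup_return_subgroup: "subgroup (return_subgroup \<Gamma> \<Phi> U) \<Gamma>"
proof (rule subgroupI)
  obtain y where y: "y \<in> U" using U_nonempty by blast
  note yX = subsetD[OF U_subset y]
  show "return_subgroup \<Gamma> \<Phi> U \<subseteq> carrier \<Gamma>" by (auto simp: return_subgroup_def)
  have "\<one> \<in> return_subgroup \<Gamma> \<Phi> U"
    using y act_one[OF yX] by (simp add: mem_return_subgroup_iff[OF y])
  then show "return_subgroup \<Gamma> \<Phi> U \<noteq> {}" by blast
  fix a assume a: "a \<in> return_subgroup \<Gamma> \<Phi> U"
  note a' = return_subgroup_carrier[OF a]
  have ay: "\<Phi> a y \<in> U" using a by (simp add: mem_return_subgroup_iff[OF y a'])
  \<comment> \<open>The inverse is tested at \<open>\<Phi> a y\<close>, which it sends back to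
    \<open>y\<close>.\<close>
  show "inv a \<in> return_subgroup \<Gamma> \<Phi> U"
    using a' y act_inv[OF a' yX] by (simp add: mem_return_subgroup_iff[OF ay])
  fix b assume b: "b \<in> return_subgroup \<Gamma> \<Phi> U"
  note b' = return_subgroup_carrier[OF b]
  have "\<Phi> b y \<in> U" using b by (simp add: mem_return_subgroup_iff[OF y b'])
  then show "a \<otimes> b \<in> return_subgroup \<Gamma> \<Phi> U"
    using return_subgroup_image[OF a] a' b'
    by (auto simp: mem_return_subgroup_iff[OF y] composition_rule[OF yX])
qed

lemma conjugate_mult:
  assumes "a \<in> carrier \<Gamma>" "b \<in> carrier \<Gamma>"
  shows "g0 \<otimes> (a \<otimes> b) \<otimes> inv g0 = (g0 \<otimes> a \<otimes> inv g0) \<otimes> (g0 \<otimes> b \<otimes> inv g0)"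
proof -
  have "inv g0 \<otimes> (g0 \<otimes> (b \<otimes> inv g0)) = b \<otimes> inv g0"
    using assms g0 by (simp flip: m_assoc)
  then show ?thesis using assms g0 by (simp add: m_assoc)
qed

lemma subgroup_H: "subgroup H \<Gamma>"
proof (rule subgroupI)
  note R = subgroup_return_subgroup
  show "H \<subseteq> carrier \<Gamma>" by (auto simp: H_def)
  have "\<one> \<in> H" using g0 by (simp add: mem_H_iff)
  then show "H \<noteq> {}" by blast
  fix a assume a: "a \<in> H"
  have "inv (g0 \<otimes> a \<otimes> inv g0) = g0 \<otimes> inv a \<otimes> inv g0"
    using H_carrier[OF a] g0 by (simp add: inv_mult_group m_assoc)
  then show "inv a \<in> H"
    using a subgroup.m_inv_closed[OF R, of "g0 \<otimes> a \<otimes> inv g0"] by (simp add: H_def)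
  fix b assume b: "b \<in> H"
  show "a \<otimes> b \<in> H"
    using a b conjugate_mult subgroup.m_closed[OF R] by (simp add: H_def)
qed

text \<open>With the shift by \<open>inv g0\<close>, the action of
  \<open>g0 \<otimes> a \<otimes> inv g0\<close> on points becomes left multiplication of labels by
  \<open>a\<close>; see \<open>act_conjugate\<close>.\<close>

definition s where "s l x = h (\<Phi> (inv g0) x) l"

lemma separating_s: "separating (subtopology X U) s"
proof -
  have "separating X s"
    unfolding s_def using separating_pullback[OF separating_model homeo[of "inv g0"]] g0 by simp
  then show ?thesis by (rule separating_subtopology)
qed

text \<open>Lying in the translate of \<open>U\<close> by \<open>inv g0\<close> is a locally
  constant condition, so by compactness the coordinate at some level \<open>l\<close> decides it.
  Elements of \<open>C l\<close> leave that coordinate of \<open>x0\<close> unchanged.\<close>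

lemma chain_subset_H: "\<exists>l\<ge>1. C l \<subseteq> H"
proof -
  have "continuous_map X (discrete_topology UNIV) (\<lambda>x. \<Phi> g0 x \<in> U)"
  proof -
    have cont: "continuous_map X X (\<Phi> g0)"
      using homeo[OF g0(1)] by (rule homeomorphic_imp_continuous_map)
    have eq: "{x \<in> topspace X. (\<Phi> g0 x \<in> U) \<in> A}
        = {x \<in> topspace X. \<Phi> g0 x \<in> {y \<in> topspace X. (y \<in> U) \<in> A}}" for A
      using act_closed[OF g0(1)] by auto
    have "openin X {y \<in> topspace X. (y \<in> U) \<in> A}" for A
    proof -
      have "{y \<in> topspace X. (y \<in> U) \<in> A}
          = (if True \<in> A then U else {}) \<union> (if False \<in> A then topspace X - U else {})"
        using U_subset by (auto split: if_splits) (metis (full_types))+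
      then show ?thesis using U_open U_closed by (simp add: openin_Un openin_diff)
    qed
    then have "openin X {x \<in> topspace X. (\<Phi> g0 x \<in> U) \<in> A}" for A
      unfolding eq using openin_continuous_map_preimage[OF cont] by blast
    then show ?thesis by (simp add: continuous_map_def)
  qed
  then obtain l where l: "\<And>x y. x \<in> topspace X \<Longrightarrow> y \<in> topspace X \<Longrightarrow> h x l = h y l \<Longrightarrow>
      (\<Phi> g0 x \<in> U) = (\<Phi> g0 y \<in> U)"
    using separating_refines[OF compact separating_model] by metis
  have "C l \<subseteq> H"
  proof
    fix \<gamma> assume \<gamma>: "\<gamma> \<in> C l"
    then have \<gamma>': "\<gamma> \<in> carrier \<Gamma>" using subgroup.mem_carrier[OF subgroup_chain] by blast
    have "h (\<Phi> \<gamma> x0) l = h x0 l"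
      using \<gamma> x0 \<gamma>' by (simp add: equivariant_component coset_join3 subgroup_chain)
    with l[of "\<Phi> \<gamma> x0" x0] have "\<Phi> g0 (\<Phi> \<gamma> x0) \<in> U"
      using x0 g0 \<gamma>' by (simp add: act_closed)
    then show "\<gamma> \<in> H" using \<gamma>' g0 x0 by (simp add: mem_H_iff composition_rule)
  qed
  \<comment> \<open>The level found may be 0, while a positive one is required.\<close>
  then show ?thesis using chain_Suc[of l] by (intro exI[of _ "Suc l"]) auto
qed

lemma finite_index_H: "finite_index_subgroup H \<Gamma>"
  using chain_subset_H finite_index_supergroup[OF finite_index_chain subgroup_H] by blast

text \<open>Fibres of \<open>s l\<close> in \<open>U\<close> are open, so the dense orbit of
  \<open>x0\<close> meets each nonempty one. The orbit points in \<open>U\<close> are those of the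
  form \<open>\<Phi> (g0 \<otimes> \<delta>) x0\<close> with
  \<open>\<delta> \<in> H\<close>.\<close>

lemma image_s: "s l ` U = (\<lambda>\<delta>. \<delta> <# C l) ` H"
proof
  show "s l ` U \<subseteq> (\<lambda>\<delta>. \<delta> <# C l) ` H"
  proof
    fix c assume "c \<in> s l ` U"
    then obtain x where x: "x \<in> U" "c = s l x" by blast
    let ?V = "{y \<in> topspace (subtopology X U). s l y \<in> {c}}"
    have "openin (subtopology X U) ?V"
      by (rule openin_continuous_map_preimage[where Y = "discrete_topology UNIV"])
        (use separating_s in \<open>auto simp: separating_def\<close>)
    then have "openin X ?V" using U_open openin_trans_full by blast
    moreover have "x \<in> ?V" using x U_subset by auto
    ultimately obtain b where b: "b \<in> carrier \<Gamma>" "\<Phi> b x0 \<in> ?V"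
      using orbit_meets_open[OF x0(1), of ?V] by blast
    define d where "d = inv g0 \<otimes> b"
    have d: "d \<in> carrier \<Gamma>" unfolding d_def using b g0 by simp
    have "g0 \<otimes> d = b" unfolding d_def using b g0 by (simp flip: m_assoc)
    then have "d \<in> H" using b d by (simp add: mem_H_iff)
    moreover have "c = d <# C l"
    proof -
      have "c = h (\<Phi> (inv g0) (\<Phi> b x0)) l" using b(2) by (simp add: s_def)
      also have "\<dots> = h (\<Phi> d x0) l"
        unfolding d_def using b g0 x0 by (simp add: composition_rule)
      also have "\<dots> = d <# C l" using d x0 by (simp add: equivariant_component)
      finally show ?thesis .
    qed
    ultimately show "c \<in> (\<lambda>\<delta>. \<delta> <# C l) ` H" by blast
  qed
  show "(\<lambda>\<delta>. \<delta> <# C l) ` H \<subseteq> s l ` U"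
  proof
    fix c assume "c \<in> (\<lambda>\<delta>. \<delta> <# C l) ` H"
    then obtain d where d: "d \<in> H" "c = d <# C l" by blast
    have d': "d \<in> carrier \<Gamma>" using H_carrier[OF d(1)] .
    have "\<Phi> (g0 \<otimes> d) x0 \<in> U" using d d' by (simp add: mem_H_iff)
    moreover have "s l (\<Phi> (g0 \<otimes> d) x0) = d <# C l"
      unfolding s_def using d' g0 x0
      by (simp add: composition_rule act_closed act_inv equivariant_component)
    ultimately show "c \<in> s l ` U" unfolding d(2) by (metis image_eqI)
  qed
qed

lemma act_conjugate:
  assumes "a \<in> carrier \<Gamma>" "x \<in> topspace X"
  shows "s l (\<Phi> (g0 \<otimes> a \<otimes> inv g0) x) = a <# s l x"
  unfolding s_def using assms g0
  by (simp add: composition_rule act_closed act_inv equivariant_component)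

text \<open>The core consists of the elements fixing every coset \<open>\<delta> <# C l\<close> with
  \<open>\<delta> \<in> H\<close>, and by \<open>image_s\<close> these cosets are the labels
  occurring on \<open>U\<close>.\<close>

lemma mem_core_iff:
  assumes a: "a \<in> carrier \<Gamma>"
  shows "a \<in> restricted_core \<Gamma> C H l \<longleftrightarrow> (\<forall>x\<in>U. s l (\<Phi> (g0 \<otimes> a \<otimes> inv g0) x) = s l x)"
proof -
  have "a \<in> restricted_core \<Gamma> C H l \<longleftrightarrow> (\<forall>c\<in>(\<lambda>\<delta>. \<delta> <# C l) ` H. a <# c = c)"
    using mem_restricted_core_iff[where C = C, OF subgroup_chain subgroup_H a] by simp
  also have "\<dots> \<longleftrightarrow> (\<forall>x\<in>U. a <# s l x = s l x)"
    unfolding image_s[symmetric] by simp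
  also have "\<dots> \<longleftrightarrow> (\<forall>x\<in>U. s l (\<Phi> (g0 \<otimes> a \<otimes> inv g0) x) = s l x)"
    using U_subset a by (intro ball_cong refl) (simp add: act_conjugate subset_iff)
  finally show ?thesis .
qed

lemma core_Suc: "restricted_core \<Gamma> C H (Suc l) \<subseteq> restricted_core \<Gamma> C H l"
  using chain_Suc[of l] unfolding restricted_core_def by blast

lemma pow_mem_core:
  assumes "\<gamma> \<in> carrier \<Gamma>"
  shows "\<exists>k::nat. k > 0 \<and> \<gamma> [^] k \<in> restricted_core \<Gamma> C H l"
proof -
  obtain k :: nat where k: "k > 0" "\<forall>\<delta>\<in>carrier \<Gamma>. \<gamma> [^] k <# (\<delta> <# C l) = \<delta> <# C l"
    using pow_fixes_lcosets[OF finite_index_chain assms] by blast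
  have "\<gamma> [^] k \<in> restricted_core \<Gamma> C H l"
    using k(2) assms H_carrier
    by (subst mem_restricted_core_iff[where C = C, OF subgroup_chain subgroup_H]) auto
  with k(1) show ?thesis by blast
qed

lemma pow_mem_H:
  assumes "\<gamma> \<in> carrier \<Gamma>"
  shows "\<exists>k::nat. k > 0 \<and> \<gamma> [^] k \<in> H"
proof -
  obtain k :: nat where k: "k > 0" "\<forall>\<delta>\<in>carrier \<Gamma>. \<gamma> [^] k <# (\<delta> <# H) = \<delta> <# H"
    using pow_fixes_lcosets[OF finite_index_H assms] by blast
  \<comment> \<open>The stabiliser of the trivial coset is \<open>H\<close> itself.\<close>
  have "\<gamma> [^] k <# (\<one> <# H) = \<one> <# H" using k(2) by blast
  then have "\<gamma> [^] k <# H = \<one> <# H"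
    using assms by (simp add: lcoset_translate subgroup_H)
  then have "\<gamma> [^] k \<in> H"
    using assms by (simp add: lcoset_eq_iff subgroup_H)
  with k(1) show ?thesis by blast
qed

section \<open>Indices of cores as periods on the adapted set\<close>

definition core_index where
  "core_index \<gamma> l = order (\<Gamma>\<lparr>carrier := generate \<Gamma> {\<gamma>}\<rparr> Mod cyclic_core \<Gamma> C H \<gamma> l)"

lemma core_index_pos: "\<gamma> \<in> carrier \<Gamma> \<Longrightarrow> core_index \<gamma> l > 0"
  and pow_mem_core_iff:
    "\<gamma> \<in> carrier \<Gamma> \<Longrightarrow> \<gamma> [^] (i::nat) \<in> restricted_core \<Gamma> C H l \<longleftrightarrow> core_index \<gamma> l dvd i"
proof -
  assume \<gamma>: "\<gamma> \<in> carrier \<Gamma>"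
  obtain k :: nat where k: "\<gamma> [^] k \<in> restricted_core \<Gamma> C H l" "k > 0"
    using pow_mem_core[OF \<gamma>] by blast
  have core: "subgroup (restricted_core \<Gamma> C H l) \<Gamma>"
    by (rule subgroup_restricted_core[where C = C, OF subgroup_chain subgroup_H])
  show "core_index \<gamma> l > 0" "\<gamma> [^] i \<in> restricted_core \<Gamma> C H l \<longleftrightarrow> core_index \<gamma> l dvd i"
    unfolding core_index_def cyclic_core_def by (rule order_cyclic_quotient[OF \<gamma> core k])+
qed

lemma steinitz_order_eq: "steinitz_order \<Gamma> C H \<gamma> = steinitz_lcm {core_index \<gamma> l | l. l > 0}"
  by (simp add: steinitz_order_def core_index_def)

text \<open>At each level the index of \<open>\<gamma> [^] k\<close> is that of
  \<open>\<gamma>\<close> divided by its gcd with \<open>k\<close>, since both numbers divide the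
  same exponents. Then \<open>steinitz_type_lcm_div_gcd\<close> applies.\<close>

lemma steinitz_type_pow:
  assumes \<gamma>: "\<gamma> \<in> carrier \<Gamma>" and "(k::nat) > 0"
  shows "steinitz_type (steinitz_order \<Gamma> C H (\<gamma> [^] k)) = steinitz_type (steinitz_order \<Gamma> C H \<gamma>)"
proof -
  have \<gamma>k: "\<gamma> [^] k \<in> carrier \<Gamma>" using \<gamma> by simp
  have "core_index (\<gamma> [^] k) l dvd i \<longleftrightarrow> core_index \<gamma> l div gcd (core_index \<gamma> l) k dvd i" for l i
    using pow_mem_core_iff[OF \<gamma>k, of i l] pow_mem_core_iff[OF \<gamma>, of "k * i" l]
      div_gcd_dvd_iff[OF \<open>k > 0\<close>] \<gamma> by (simp add: nat_pow_pow)
  then have "core_index (\<gamma> [^] k) l = core_index \<gamma> l div gcd (core_index \<gamma> l) k" for l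
    by (meson dvd_antisym dvd_refl)
  moreover have "core_index \<gamma> l dvd core_index \<gamma> (Suc l)" for l
  proof -
    have "\<gamma> [^] core_index \<gamma> (Suc l) \<in> restricted_core \<Gamma> C H (Suc l)"
      by (simp add: pow_mem_core_iff[OF \<gamma>])
    then have "\<gamma> [^] core_index \<gamma> (Suc l) \<in> restricted_core \<Gamma> C H l"
      by (rule subsetD[OF core_Suc])
    then show ?thesis by (simp add: pow_mem_core_iff[OF \<gamma>])
  qed
  ultimately show ?thesis
    unfolding steinitz_order_eq
    using steinitz_type_lcm_div_gcd[of "core_index \<gamma>", OF core_index_pos[OF \<gamma>] _ \<open>k > 0\<close>] by simp
qed

lemma funpow_conjugate:
  assumes "\<gamma> \<in> H" "x \<in> U"
  shows "(restrict (\<Phi> (g0 \<otimes> \<gamma> \<otimes> inv g0)) U ^^ k) x = \<Phi> (g0 \<otimes> \<gamma> [^] k \<otimes> inv g0) x"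
proof (induction k)
  case 0
  show ?case using assms(2) U_subset g0 act_one by auto
next
  case (Suc k)
  have \<gamma>: "\<gamma> \<in> carrier \<Gamma>" using assms(1) by (rule H_carrier)
  have x: "x \<in> topspace X" using assms(2) U_subset by blast
  \<comment> \<open>The restricted map is \<open>undefined\<close> off \<open>U\<close>, so its
    iterates can be unfolded only because all intermediate points stay in \<open>U\<close>.\<close>
  have "\<gamma> [^] k \<in> H"
    using assms(1) by (induction k) (simp_all add: subgroup.one_closed subgroup.m_closed subgroup_H)
  then have "\<Phi> (g0 \<otimes> \<gamma> [^] k \<otimes> inv g0) x \<in> U"
    using return_subgroup_image assms(2) unfolding H_def by blast
  moreover have "g0 \<otimes> \<gamma> [^] Suc k \<otimes> inv g0 = (g0 \<otimes> \<gamma> \<otimes> inv g0) \<otimes> (g0 \<otimes> \<gamma> [^] k \<otimes> inv g0)"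
    using \<gamma> conjugate_mult[of \<gamma> "\<gamma> [^] k"] by (simp only: nat_pow_Suc2 nat_pow_closed)
  ultimately show ?case
    using Suc \<gamma> x g0 composition_rule[of x "g0 \<otimes> \<gamma> \<otimes> inv g0" "g0 \<otimes> \<gamma> [^] k \<otimes> inv g0"]
    by simp
qed

text \<open>By \<open>mem_core_iff\<close>, the iterates preserving all labels on \<open>U\<close>
  are those whose exponent is a multiple of the core index, and the \<open>Gcd\<close> of all
  multiples of a number is that number.\<close>

lemma period_eq:
  assumes "\<gamma> \<in> H"
  shows "period U (s l) (restrict (\<Phi> (g0 \<otimes> \<gamma> \<otimes> inv g0)) U) = core_index \<gamma> l"
proof -
  have \<gamma>: "\<gamma> \<in> carrier \<Gamma>" using assms by (rule H_carrier)
  have "period U (s l) (restrict (\<Phi> (g0 \<otimes> \<gamma> \<otimes> inv g0)) U) = Gcd {k. core_index \<gamma> l dvd k}"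
    unfolding period_def
    using \<gamma> mem_core_iff pow_mem_core_iff[OF \<gamma>]
    by (simp add: funpow_conjugate[OF assms] cong: ball_cong)
  also have "\<dots> = core_index \<gamma> l"
    by (rule dvd_antisym) (auto intro: Gcd_dvd Gcd_greatest)
  finally show ?thesis .
qed

lemma carrier_holonomy_group:
  "carrier (holonomy_group \<Gamma> \<Phi> U) = (\<lambda>\<gamma>. restrict (\<Phi> (g0 \<otimes> \<gamma> \<otimes> inv g0)) U) ` H"
proof -
  have "return_subgroup \<Gamma> \<Phi> U = (\<lambda>\<gamma>. g0 \<otimes> \<gamma> \<otimes> inv g0) ` H"
  proof
    show "(\<lambda>\<gamma>. g0 \<otimes> \<gamma> \<otimes> inv g0) ` H \<subseteq> return_subgroup \<Gamma> \<Phi> U" by (auto simp: H_def)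
    show "return_subgroup \<Gamma> \<Phi> U \<subseteq> (\<lambda>\<gamma>. g0 \<otimes> \<gamma> \<otimes> inv g0) ` H"
    proof
      fix a assume a: "a \<in> return_subgroup \<Gamma> \<Phi> U"
      note a' = return_subgroup_carrier[OF a]
      have "g0 \<otimes> (inv g0 \<otimes> a \<otimes> g0) \<otimes> inv g0 = a"
        using a' g0 by (simp add: inv_solve_right' flip: m_assoc)
      with a a' g0 show "a \<in> (\<lambda>\<gamma>. g0 \<otimes> \<gamma> \<otimes> inv g0) ` H"
        by (intro image_eqI[of _ _ "inv g0 \<otimes> a \<otimes> g0"]) (simp_all add: H_def)
    qed
  qed
  then show ?thesis by (simp add: holonomy_group_def image_image)
qed

lemma period_pos:
  "f \<in> carrier (holonomy_group \<Gamma> \<Phi> U) \<Longrightarrow> period U (s l) f > 0"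
  using period_eq core_index_pos H_carrier unfolding carrier_holonomy_group by auto

text \<open>The right side sees a group element only through the homeomorphism it induces on
  \<open>U\<close>, which is the data an isomorphism of holonomy actions can match.\<close>

lemma restricted_typeset_H:
  "restricted_typeset \<Gamma> C H
     = (\<lambda>f. steinitz_type (steinitz_period U s f)) ` carrier (holonomy_group \<Gamma> \<Phi> U)"
proof -
  have "restricted_typeset \<Gamma> C H = (\<lambda>\<gamma>. steinitz_type (steinitz_order \<Gamma> C H \<gamma>)) ` H"
  proof
    show "restricted_typeset \<Gamma> C H \<subseteq> (\<lambda>\<gamma>. steinitz_type (steinitz_order \<Gamma> C H \<gamma>)) ` H"
    proof
      fix \<tau> assume "\<tau> \<in> restricted_typeset \<Gamma> C H"
      then obtain \<gamma> where \<gamma>: "\<gamma> \<in> carrier \<Gamma>" "\<tau> = steinitz_type (steinitz_order \<Gamma> C H \<gamma>)"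
        unfolding restricted_typeset_def by blast
      obtain k :: nat where "k > 0" "\<gamma> [^] k \<in> H" using pow_mem_H[OF \<gamma>(1)] by blast
      then show "\<tau> \<in> (\<lambda>\<gamma>. steinitz_type (steinitz_order \<Gamma> C H \<gamma>)) ` H"
        using steinitz_type_pow[OF \<gamma>(1)] \<gamma>(2) by (metis image_eqI)
    qed
    show "(\<lambda>\<gamma>. steinitz_type (steinitz_order \<Gamma> C H \<gamma>)) ` H \<subseteq> restricted_typeset \<Gamma> C H"
      using H_carrier unfolding restricted_typeset_def by blast
  qed
  also have "\<dots> = (\<lambda>\<gamma>. steinitz_type (steinitz_period U s
      (restrict (\<Phi> (g0 \<otimes> \<gamma> \<otimes> inv g0)) U))) ` H"
    by (intro image_cong refl) (simp add: steinitz_order_eq steinitz_period_def period_eq)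
  finally show ?thesis by (simp add: carrier_holonomy_group image_image)
qed

lemma compact_U: "compact_space (subtopology X U)"
  using compact U_closed by (simp add: closedin_compact_space compact_space_subtopology)

lemma holonomy_image: "f \<in> carrier (holonomy_group \<Gamma> \<Phi> U) \<Longrightarrow> f ` U = U"
proof -
  assume "f \<in> carrier (holonomy_group \<Gamma> \<Phi> U)"
  then obtain a where "a \<in> return_subgroup \<Gamma> \<Phi> U" "f = restrict (\<Phi> a) U"
    by (auto simp: holonomy_group_def)
  then show "f ` U = U" by (simp add: return_subgroup_image)
qed

end

section \<open>Matching the two holonomy actions\<close>

lemma cantor_space_compact: "cantor_space X \<Longrightarrow> compact_space X"
  unfolding cantor_space_def
  by (metis compact_space_discrete_topology compact_space_product_topology finite_code
      homeomorphic_compact_space)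

lemma modelled_odometerI:
  assumes "odometer X \<Gamma> \<Phi>" "group_chain_model X \<Gamma> \<Phi> C" "adapted X \<Gamma> \<Phi> U"
  shows "\<exists>h. modelled_odometer \<Gamma> X \<Phi> C h U"
proof -
  obtain h where h: "homeomorphic_map X (chain_limit \<Gamma> C) h"
    "\<forall>g\<in>carrier \<Gamma>. \<forall>x\<in>topspace X. h (\<Phi> g x) = chain_action \<Gamma> g (h x)"
    using assms(2) unfolding group_chain_model_def by blast
  have "modelled_odometer \<Gamma> X \<Phi> C h U"
    unfolding modelled_odometer_def modelled_odometer_axioms_def
    using assms h cantor_space_compact[of X]
    by (simp add: odometer_def cantor_action_def group_chain_model_def)
  then show ?thesis by blast
qed

theorem theorem1p8:
  fixes X :: "'x topology" and \<Gamma> :: "('g, 'm) monoid_scheme" and \<Phi> :: "'g \<Rightarrow> 'x \<Rightarrow> 'x"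
    and X' :: "'y topology" and \<Gamma>' :: "('h, 'n) monoid_scheme" and \<Phi>' :: "'h \<Rightarrow> 'y \<Rightarrow> 'y"
  assumes "odometer X \<Gamma> \<Phi>" and "odometer X' \<Gamma>' \<Phi>'"
    and "return_equivalent X \<Gamma> \<Phi> X' \<Gamma>' \<Phi>'"
  shows "odometer_typesets_commensurable X \<Gamma> \<Phi> X' \<Gamma>' \<Phi>'"
  unfolding odometer_typesets_commensurable_def
proof (intro allI impI, elim conjE)
  fix C C' assume C: "group_chain_model X \<Gamma> \<Phi> C" and C': "group_chain_model X' \<Gamma>' \<Phi>' C'"
  obtain U U' \<phi> \<psi> \<Theta> where U: "adapted X \<Gamma> \<Phi> U" and U': "adapted X' \<Gamma>' \<Phi>' U'"
    and \<phi>: "homeomorphic_maps (subtopology X U) (subtopology X' U') \<phi> \<psi>"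
    and \<Theta>: "\<Theta> \<in> iso (holonomy_group \<Gamma> \<Phi> U) (holonomy_group \<Gamma>' \<Phi>' U')"
    and conj: "\<forall>f\<in>carrier (holonomy_group \<Gamma> \<Phi> U). \<forall>x\<in>topspace (subtopology X U).
      f x = \<psi> (\<Theta> f (\<phi> x))"
    using assms(3) unfolding return_equivalent_def isomorphic_actions_def by blast
  obtain h where "modelled_odometer \<Gamma> X \<Phi> C h U"
    using modelled_odometerI[OF assms(1) C U] by blast
  then interpret M: modelled_odometer \<Gamma> X \<Phi> C h U .
  obtain h' where "modelled_odometer \<Gamma>' X' \<Phi>' C' h' U'"
    using modelled_odometerI[OF assms(2) C' U'] by blast
  then interpret M': modelled_odometer \<Gamma>' X' \<Phi>' C' h' U' .
  have top: "topspace (subtopology X U) = U" "topspace (subtopology X' U') = U'"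
    using M.U_subset M'.U_subset by (auto simp: topspace_subtopology)
  have bij: "bij_betw \<Theta> (carrier (holonomy_group \<Gamma> \<Phi> U)) (carrier (holonomy_group \<Gamma>' \<Phi>' U'))"
    using \<Theta> by (simp add: iso_def)
  have \<phi>_map: "homeomorphic_map (subtopology X U) (subtopology X' U') \<phi>"
    using \<phi> homeomorphic_map_maps by blast
  have "steinitz_period U M.s f = steinitz_period U' M'.s (\<Theta> f)"
    if f: "f \<in> carrier (holonomy_group \<Gamma> \<Phi> U)" for f
  proof -
    have \<Theta>f: "\<Theta> f \<in> carrier (holonomy_group \<Gamma>' \<Phi>' U')"
      using bij f by (rule bij_betwE[THEN bspec])
    \<comment> \<open>The hypothesis has \<open>\<psi>\<close> on the outside. Applying
      \<open>\<phi>\<close> removes it, because \<open>\<Theta> f\<close> maps \<open>U'\<close> to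
      itself and so the argument of \<open>\<psi>\<close> lies in \<open>U'\<close>.\<close>
    have "\<phi> (f x) = \<Theta> f (\<phi> x)" if "x \<in> U" for x
    proof -
      have "\<phi> x \<in> U'"
        using homeomorphic_imp_surjective_map[OF \<phi>_map] \<open>x \<in> U\<close> unfolding top by blast
      then have "\<Theta> f (\<phi> x) \<in> U'" using M'.holonomy_image[OF \<Theta>f] by blast
      then have "\<phi> (\<psi> (\<Theta> f (\<phi> x))) = \<Theta> f (\<phi> x)"
        using \<phi> unfolding homeomorphic_maps_def top by blast
      moreover have "f x = \<psi> (\<Theta> f (\<phi> x))"
        using conj f \<open>x \<in> U\<close> unfolding top by blast
      ultimately show ?thesis by simp
    qed
    then show ?thesis
      using steinitz_period_conjugate[OF M.compact_U M.separating_s M'.separating_s \<phi>_map, of f "\<Theta> f"]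
        M.holonomy_image[OF f] M.period_pos[OF f] M'.period_pos[OF \<Theta>f]
      unfolding top by simp
  qed
  \<comment> \<open>Surjectivity of \<open>\<Theta>\<close> lets the second typeset be indexed by
    the first holonomy group.\<close>
  then have "restricted_typeset \<Gamma> C M.H = restricted_typeset \<Gamma>' C' M'.H"
    unfolding M.restricted_typeset_H M'.restricted_typeset_H
      bij_betw_imp_surj_on[OF bij, symmetric] image_image
    by (intro image_cong refl) simp
  then show "commensurable_typesets \<Gamma> C \<Gamma>' C'"
    unfolding commensurable_typesets_def
    using M.finite_index_H M'.finite_index_H M.chain_subset_H M'.chain_subset_H by blast
qed

end
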